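(* Let $$v_{16}^{\mathrm{GHZ}_3}=\Big(\tfrac{1}{2}+\tfrac{\sqrt{2}}{3}-\tfrac{120\cos\frac{\pi}{8}+56\sin\frac{\pi}{8}}{137}+\tfrac{11960704\cos\frac{\pi}{16}-11459008\sin\frac{\pi}{16}}{9508049}+\tfrac{15419776\cos\frac{3\pi}{16}-5453760\sin\frac{3\pi}{16}}{9508049}\Big)^{-1}\approx0.49160 .$$ Then $v_{16}^{\mathrm{GHZ}_3}$ is exactly the nonlocality threshold of the three-qubit GHZ state when each of the three parties uses the $m=16$ observables $$A_{x}=\cos\tfrac{(x-1)\pi}{16}\,\sigma_X+\sin\tfrac{(x-1)\pi}{16}\,\sigma_Y,\qquad x=1,\ldots,16 .$$ In particular, the nonlocality threshold under all projective measurements satisfies $v_c^{\mathrm{GHZ}_3}\leq v_{16}^{\mathrm{GHZ}_3}$.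
   Context: Let $|\mathrm{GHZ}_3\rangle=\frac{|000\rangle+|111\rangle}{\sqrt2}\in(\mathbb{C}^2)^{\otimes3}$ and, for $v\in[0,1]$, $\rho_v=v\,|\mathrm{GHZ}_3\rangle\langle\mathrm{GHZ}_3|+(1-v)\frac{I}{8}$. Each of three parties $n=1,2,3$ measures one qubit with an observable $\hat x_n\cdot\vec\sigma$, where $\hat x_n$ is a unit vector of $\mathbb{R}^3$ and $\vec\sigma=(\sigma_X,\sigma_Y,\sigma_Z)$ is the vector of Pauli matrices, with outcome $a_n=\pm1$. The outcome probabilities are $p_v(a_1a_2a_3|\hat x_1\hat x_2\hat x_3)=\mathrm{Tr}\big[\rho_v\bigotimes_{n=1}^3\frac{I+a_n\hat x_n\cdot\vec\sigma}{2}\big]$. For a set $S$ of unit vectors of $\mathbb{R}^3$, the state $\rho_v$ is local under the measurements in $S$ if there are a probability space $(\Lambda,\mu)$ and conditional probabilities $p^{(n)}_\lambda(a_n|\hat x_n)$, measurable in $\lambda$, such that $p_v(a_1a_2a_3|\hat x_1\hat x_2\hat x_3)=\int_\Lambda\prod_{n=1}^3p^{(n)}_\lambda(a_n|\hat x_n)\,d\mu(\lambda)$ for all $a_1,a_2,a_3\in\{\pm1\}$ and $\hat x_1,\hat x_2,\hat x_3\in S$. The nonlocality threshold for the measurements in $S$ is the supremum of the $v\in[0,1]$ for which $\rho_v$ is local under the measurements in $S$; for $S$ the whole unit sphere (all projective measurements) it is denoted $v_c^{\mathrm{GHZ}_3}$. *)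

theory Defs
  imports "HOL-Analysis.Analysis" "HOL-Probability.Probability_Measure"
begin

section \<open>Qubits and the noisy GHZ state\<close>

text \<open>
  The numeral type \<open>2\<close> indexes the computational basis of a qubit. Following \<^const>\<open>vector\<close>,
  index \<open>1\<close> is the first basis vector (ket 0) and index \<open>2\<close>, which equals \<open>0\<close> in this type, is
  the second one (ket 1). The numeral type \<open>3\<close> indexes the parties (and the coordinates of
  \<open>real^3\<close>), so the three-qubit space has the basis \<open>3 \<Rightarrow> 2\<close>.
\<close>

type_synonym qubit_op = "complex^2^2"
type_synonym three_qubit_ket = "complex^(3 \<Rightarrow> 2)"
type_synonym three_qubit_op = "complex^(3 \<Rightarrow> 2)^(3 \<Rightarrow> 2)"

definition pauli_X :: qubit_op where
  "pauli_X = vector [vector [0, 1], vector [1, 0]]"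

definition pauli_Y :: qubit_op where
  "pauli_Y = vector [vector [0, - \<i>], vector [\<i>, 0]]"

definition pauli_Z :: qubit_op where
  "pauli_Z = vector [vector [1, 0], vector [0, - 1]]"

definition pauli_dot :: "real^3 \<Rightarrow> qubit_op" where
  "pauli_dot x = (x $ 1) *\<^sub>R pauli_X + (x $ 2) *\<^sub>R pauli_Y + (x $ 3) *\<^sub>R pauli_Z"

definition tensor_op :: "(3 \<Rightarrow> qubit_op) \<Rightarrow> three_qubit_op" where
  "tensor_op B = (\<chi> i j. \<Prod>n\<in>UNIV. B n $ i n $ j n)"

definition ket_bra :: "three_qubit_ket \<Rightarrow> three_qubit_op" where
  "ket_bra \<psi> = (\<chi> i j. \<psi> $ i * cnj (\<psi> $ j))"

definition GHZ_ket :: three_qubit_ket where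
  "GHZ_ket = (1 / sqrt 2) *\<^sub>R (axis (\<lambda>_. 1) 1 + axis (\<lambda>_. 2) 1)"

definition noisy_GHZ :: "real \<Rightarrow> three_qubit_op" where
  "noisy_GHZ v = v *\<^sub>R ket_bra GHZ_ket + ((1 - v) / 8) *\<^sub>R mat 1"

definition outcome_effect :: "real \<Rightarrow> real^3 \<Rightarrow> qubit_op" where
  "outcome_effect a x = (1 / 2) *\<^sub>R (mat 1 + a *\<^sub>R pauli_dot x)"

definition GHZ_prob :: "real \<Rightarrow> (3 \<Rightarrow> real) \<Rightarrow> (3 \<Rightarrow> real^3) \<Rightarrow> complex" where
  "GHZ_prob v a x = trace (noisy_GHZ v ** tensor_op (\<lambda>n. outcome_effect (a n) (x n)))"


section \<open>Local models\<close>

text \<open>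
  \<open>q n \<omega> a x\<close> is the probability that party \<open>n\<close> outputs \<open>a\<close> when measuring along \<open>x\<close>,
  given the hidden variable \<open>\<omega>\<close>.
\<close>

definition is_local_model ::
  "'l measure \<Rightarrow> (3 \<Rightarrow> 'l \<Rightarrow> real \<Rightarrow> real^3 \<Rightarrow> real) \<Rightarrow> (real^3) set \<Rightarrow> real \<Rightarrow> bool" where
  "is_local_model M q S v \<longleftrightarrow>
     prob_space M \<and>
     (\<forall>n. \<forall>x\<in>S. \<forall>a\<in>{1, - 1}. (\<lambda>\<omega>. q n \<omega> a x) \<in> borel_measurable M) \<and>
     (\<forall>n. \<forall>\<omega>\<in>space M. \<forall>x\<in>S.
        0 \<le> q n \<omega> 1 x \<and> 0 \<le> q n \<omega> (- 1) x \<and> q n \<omega> 1 x + q n \<omega> (- 1) x = 1) \<and>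
     (\<forall>a x. (\<forall>n. a n \<in> {1, - 1} \<and> x n \<in> S) \<longrightarrow>
        GHZ_prob v a x = complex_of_real (\<integral>\<omega>. (\<Prod>n\<in>UNIV. q n \<omega> (a n) (x n)) \<partial>M))"

text \<open>
  HOL cannot quantify existentially over the type of hidden variables. The type below can carry
  all response functions at once, so by lemma \<open>GHZ_local_if_local_model\<close> fixing it
  does not restrict the hidden-variable spaces.
\<close>

definition GHZ_local :: "(real^3) set \<Rightarrow> real \<Rightarrow> bool" where
  "GHZ_local S v \<longleftrightarrow> (\<exists>(M :: (3 \<times> (real^3) \<Rightarrow> real) measure) q. is_local_model M q S v)"

definition GHZ_threshold :: "(real^3) set \<Rightarrow> real" where
  "GHZ_threshold S = Sup {v \<in> {0..1}. GHZ_local S v}"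

lemma GHZ_local_if_local_model:
  fixes M :: "'l measure"
  assumes "is_local_model M q S v"
  shows "GHZ_local S v"
proof -
  define I where "I = (UNIV :: 3 set) \<times> S"
  define N where "N = Pi\<^sub>M I (\<lambda>_. borel :: real measure)"
  define h where "h = (\<lambda>\<omega>. \<lambda>i\<in>I. q (fst i) \<omega> 1 (snd i))"
  define clip where "clip = (\<lambda>t :: real. max 0 (min 1 t))"
  define r where "r = (\<lambda>n (f :: 3 \<times> (real^3) \<Rightarrow> real) (a :: real) x.
    if a = 1 then clip (f (n, x)) else 1 - clip (f (n, x)))"
  have ps: "prob_space M"
    and meas: "\<And>n x a. x \<in> S \<Longrightarrow> a \<in> {1, - 1} \<Longrightarrow> (\<lambda>\<omega>. q n \<omega> a x) \<in> borel_measurable M"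
    and pr: "\<And>n x \<omega>. \<omega> \<in> space M \<Longrightarrow> x \<in> S \<Longrightarrow>
        0 \<le> q n \<omega> 1 x \<and> 0 \<le> q n \<omega> (- 1) x \<and> q n \<omega> 1 x + q n \<omega> (- 1) x = 1"
    and rep: "\<And>a x. (\<And>n. a n \<in> {1, - 1} \<and> x n \<in> S) \<Longrightarrow>
        GHZ_prob v a x = complex_of_real (\<integral>\<omega>. (\<Prod>n\<in>UNIV. q n \<omega> (a n) (x n)) \<partial>M)"
    using assms unfolding is_local_model_def by blast+
  have h: "h \<in> measurable M N"
    unfolding h_def N_def
    by (rule measurable_restrict) (use meas in \<open>auto simp: I_def\<close>)
  have clip_meas: "(\<lambda>f. clip (f (n, x))) \<in> borel_measurable N" if "x \<in> S" for n x
  proof -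
    have "(\<lambda>f. f (n, x)) \<in> borel_measurable N"
      unfolding N_def using that by (intro measurable_component_singleton) (auto simp: I_def)
    then show ?thesis unfolding clip_def by measurable
  qed
  have r_meas: "(\<lambda>f. r n f a x) \<in> borel_measurable N" if "x \<in> S" for n a x
    using clip_meas[OF that] by (cases "a = 1") (simp_all add: r_def)
  have r_h: "r n (h \<omega>) a x = q n \<omega> a x"
    if "\<omega> \<in> space M" "x \<in> S" "a \<in> {1, - 1}" for n \<omega> a x
    using pr[OF that(1,2), of n] that(2,3) by (auto simp: r_def h_def I_def clip_def)
  have "is_local_model (distr M N h) r S v"
    unfolding is_local_model_def
  proof (intro conjI allI ballI impI)
    show "prob_space (distr M N h)"
      using ps h by (rule prob_space.prob_space_distr)
  next
    fix n x a assume "x \<in> S"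
    then show "(\<lambda>f. r n f a x) \<in> borel_measurable (distr M N h)"
      using r_meas by simp
  next
    fix a :: "3 \<Rightarrow> real" and x :: "3 \<Rightarrow> real^3" assume ax: "\<forall>n. a n \<in> {1, - 1} \<and> x n \<in> S"
    have "(\<integral>f. (\<Prod>n\<in>UNIV. r n f (a n) (x n)) \<partial>distr M N h) =
          (\<integral>\<omega>. (\<Prod>n\<in>UNIV. r n (h \<omega>) (a n) (x n)) \<partial>M)"
      using ax h r_meas by (intro integral_distr borel_measurable_prod) auto
    also have "\<dots> = (\<integral>\<omega>. (\<Prod>n\<in>UNIV. q n \<omega> (a n) (x n)) \<partial>M)"
      using ax r_h by (intro Bochner_Integration.integral_cong prod.cong) auto
    finally show "GHZ_prob v a x =
        complex_of_real (\<integral>f. (\<Prod>n\<in>UNIV. r n f (a n) (x n)) \<partial>distr M N h)"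
      using rep ax by simp
  qed (auto simp: r_def clip_def)
  then show ?thesis unfolding GHZ_local_def by blast
qed


section \<open>The thresholds\<close>

definition equatorial_direction :: "nat \<Rightarrow> nat \<Rightarrow> real^3" where
  "equatorial_direction m x =
     vector [cos ((real x - 1) * pi / real m), sin ((real x - 1) * pi / real m), 0]"

lemma pauli_dot_equatorial_direction:
  "pauli_dot (equatorial_direction m x) =
     cos ((real x - 1) * pi / real m) *\<^sub>R pauli_X + sin ((real x - 1) * pi / real m) *\<^sub>R pauli_Y"
  by (simp add: pauli_dot_def equatorial_direction_def)

definition vc_GHZ3 :: real where
  "vc_GHZ3 = GHZ_threshold (sphere 0 1)"

definition v16_GHZ3 :: real where
  "v16_GHZ3 = inverse
     (1 / 2 + sqrt 2 / 3
      - (120 * cos (pi / 8) + 56 * sin (pi / 8)) / 137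
      + (11960704 * cos (pi / 16) - 11459008 * sin (pi / 16)) / 9508049
      + (15419776 * cos (3 * pi / 16) - 5453760 * sin (3 * pi / 16)) / 9508049)"

end

theory Submission
  imports Defs
begin

text \<open>
  For equatorial directions the one- and two-party marginals of the GHZ state vanish and the full correlator depends
  only on the sum \<open>s\<close> of the three settings: it is \<open>v cos (s pi / 16)\<close>. Extending the responses of
  each party to antiperiodic sign sequences on the integers (\<open>a (x + 16) = - a x\<close>) makes the problem invariant under
  shifts, and locality becomes membership of \<open>v cos (s pi / 16)\<close> in the hull of the convolutions of three sign sequences.

  Lower bound: the interval sequence (all signs equal on one half period) and its dilations by the odd residues modulo 32,
  averaged over all shifts, have the cosine as an explicit positive combination.

  Upper bound: a Bell functional \<open>F (x + y + z)\<close> with flat Fourier spectrum. By Cauchy-Schwarz and Parseval its value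
  at \<open>(a, b, c)\<close> is controlled by the product of the autocorrelations of any two of the sequences, so it can
  only be large if at least two of them have large autocorrelation energy. Up to shifts and dilations there are four such
  sequences: the interval, and the interval with one sign flipped near its end. For these the functional is evaluated exactly.
\<close>

section \<open>Antiperiodic sequences\<close>

text \<open>Threshold and local model are the two sides of a linear program. Correlators that are
  even and antiperiodic have eight free values, at the sums 0 to 7, and the odd residues modulo 32
  give, up to sign, eight dilations of the interval. The weights solve this square system and the
  Bell coefficients the transposed one, normalised so that all eight dilated intervals reach the
  local bound. All weights are positive, so both bounds meet at the same visibility.

  The obstacle is the local bound: triples of sign sequences are too many to enumerate. Only pairs
  are examined, the third party being given its best reply. The Fourier estimate settles a pair
  whose autocorrelations have inner product at most 928. Two energies up to 928 guarantee this, and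
  among three sequences two always lie on the same side of 928. Two larger ones from different
  dilations still have a small inner product; only a common dilation needs exact evaluation.
  Dilation invariance keeps the search for the exceptional sequences small: in the best dilation the
  autocorrelation at lag 1 is at least 6, which leaves few sign changes.\<close>

definition antiperiodic :: "(int \<Rightarrow> 'a::ab_group_add) \<Rightarrow> bool" where
  "antiperiodic f \<longleftrightarrow> (\<forall>x. f (x + 16) = - f x)"

definition sign_seq :: "(int \<Rightarrow> int) \<Rightarrow> bool" where
  "sign_seq a \<longleftrightarrow> antiperiodic a \<and> (\<forall>x. a x = 1 \<or> a x = - 1)"

abbreviation I16 :: "int set" where "I16 \<equiv> {0..<16}"

lemma antiperiodicD: "antiperiodic f \<Longrightarrow> f (x + 16) = - f x"
  by (simp add: antiperiodic_def)

lemma antiperiodic_minus: "antiperiodic f \<Longrightarrow> f (x - 16) = - f x"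
  using antiperiodicD[of f "x - 16"] by simp

lemma antiperiodic_odd_mult:
  assumes "antiperiodic f" "odd u"
  shows "f (x + 16 * u) = - f x"
proof -
  have per: "f (x + 32 * int n) = f x" for x n
  proof (induction n)
    case (Suc n)
    have "f (x + 32 * int (Suc n)) = f ((x + 32 * int n) + 16 + 16)" by (simp add: algebra_simps)
    then show ?case using Suc by (simp only: antiperiodicD[OF assms(1)]) simp
  qed simp
  have per': "f (x + 32 * k) = f x" for x k
  proof (cases "k \<ge> 0")
    case True then show ?thesis using per[of x "nat k"] by simp
  next
    case False then show ?thesis using per[of "x + 32 * k" "nat (- k)"] by simp
  qed
  obtain k where "u = 2 * k + 1" using assms(2) by (elim oddE)
  then have "x + 16 * u = (x + 16) + 32 * k" by simp
  then have "f (x + 16 * u) = f (x + 16 + 32 * k)" by (rule arg_cong)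
  then show ?thesis using per'[of "x + 16" k] antiperiodicD[OF assms(1), of x] by simp
qed

lemma antiperiodic_mod:
  assumes "antiperiodic f"
  shows "f (x mod 32) = f x"
proof -
  have "f (x mod 32) = - f (x mod 32 + 16)" by (simp add: antiperiodicD[OF assms])
  also have "f (x mod 32 + 16) = - f (x mod 32 + 16 + 16 * (2 * (x div 32) - 1))"
    by (subst antiperiodic_odd_mult[OF assms]) auto
  also have "x mod 32 + 16 + 16 * (2 * (x div 32) - 1) = x"
    using mult_div_mod_eq[of 32 x] by (simp add: algebra_simps)
  finally show ?thesis by simp
qed

lemma antiperiodic_cong:
  assumes "antiperiodic f" "x mod 32 = y mod 32"
  shows "f x = f y"
  by (metis antiperiodic_mod[OF assms(1)] assms(2))

lemma antiperiodic_eqI: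
  assumes "antiperiodic f" "antiperiodic g" "\<And>x. x \<in> I16 \<Longrightarrow> f x = g x"
  shows "f x = g x"
proof (cases "x mod 32 < 16")
  case True
  then have "f (x mod 32) = g (x mod 32)" by (intro assms(3)) simp
  then show ?thesis by (simp add: antiperiodic_mod assms(1,2))
next
  case False
  moreover have "x mod 32 < 32" by simp
  ultimately have "f (x mod 32 - 16) = g (x mod 32 - 16)" by (intro assms(3)) simp
  then show ?thesis
    by (simp add: antiperiodic_mod antiperiodic_minus assms(1,2))
qed

lemma antiperiodic_dilate: "antiperiodic f \<Longrightarrow> odd u \<Longrightarrow> antiperiodic (\<lambda>x. f (u * x))"
  using antiperiodic_odd_mult[of f u] by (auto simp: antiperiodic_def algebra_simps)

lemma antiperiodic_shift: "antiperiodic f \<Longrightarrow> antiperiodic (\<lambda>x. f (x + t))"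
  unfolding antiperiodic_def by (metis add.commute add.left_commute)

lemma antiperiodic_reflect: "antiperiodic f \<Longrightarrow> antiperiodic (\<lambda>x. f (t - x))"
  unfolding antiperiodic_def by (metis antiperiodic_def antiperiodic_minus diff_diff_eq)

text \<open>An affine map with odd slope permutes the residues modulo 16. Products of two
  antiperiodic sequences have period 16, so this gives the shift and dilation invariance of the sums
  below.\<close>

lemma sum_periodic:
  fixes p :: "int \<Rightarrow> 'a::comm_monoid_add"
  assumes per: "\<And>x. p (x + 16) = p x" and u: "odd u"
  shows "(\<Sum>x\<in>I16. p (u * x + t)) = (\<Sum>x\<in>I16. p x)"
proof -
  have pn: "p (x + 16 * int n) = p x" for x n
  proof (induction n)
    case (Suc n)
    have "p (x + 16 * int (Suc n)) = p ((x + 16 * int n) + 16)" by (simp add: algebra_simps)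
    then show ?case using Suc per by simp
  qed simp
  have pk: "p (x + 16 * k) = p x" for x k
    using pn[of x "nat k"] pn[of "x + 16 * k" "nat (- k)"] by (cases "k \<ge> 0") auto
  have pm: "p (x mod 16) = p x" for x
    using pk[of "x mod 16" "x div 16"] by simp
  define h where "h = (\<lambda>x. (u * x + t) mod 16)"
  have inj: "inj_on h I16"
  proof (rule inj_onI)
    fix x y assume xy: "x \<in> I16" "y \<in> I16" "h x = h y"
    then have "(16::int) dvd (u * x + t) - (u * y + t)" unfolding h_def by (simp add: mod_eq_dvd_iff)
    then have "(16::int) dvd u * (x - y)" by (simp add: algebra_simps)
    moreover have "coprime (16::int) u"
      using u coprime_power_left_iff[of "2::int" 4 u] by simp
    ultimately have "16 dvd x - y" by (simp add: coprime_dvd_mult_right_iff)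
    with xy(1,2) show "x = y" unfolding dvd_def by (auto, presburger)
  qed
  have "h ` I16 \<subseteq> I16" by (auto simp: h_def)
  then have "h ` I16 = I16"
    by (rule endo_inj_surj[OF _ _ inj, rotated]) simp
  with inj have "bij_betw h I16 I16"
    by (rule bij_betw_imageI)
  then have "(\<Sum>x\<in>I16. p (h x)) = (\<Sum>x\<in>I16. p x)" by (rule sum.reindex_bij_betw)
  then show ?thesis by (simp add: h_def pm)
qed

lemmas sum_periodic_shift = sum_periodic[where u = 1, simplified]
lemmas sum_periodic_dilate = sum_periodic[where t = 0, simplified]

definition autocorr :: "(int \<Rightarrow> int) \<Rightarrow> int \<Rightarrow> int" where
  "autocorr a d = (\<Sum>x\<in>I16. a x * a (x + d))"

lemma antiperiodic_mult_periodic: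
  fixes f g :: "int \<Rightarrow> 'a::ring"
  assumes "antiperiodic f" "antiperiodic g"
  shows "f (x + 16) * g (y + 16) = f x * g y"
  using assms by (simp add: antiperiodicD)

lemma antiperiodic_autocorr: "antiperiodic a \<Longrightarrow> antiperiodic (autocorr a)"
  by (simp add: antiperiodic_def autocorr_def sum_negf flip: add.assoc)

lemma antiperiodic_mult_shift:
  fixes f g :: "int \<Rightarrow> 'a::ring"
  assumes "antiperiodic f" "antiperiodic g"
  shows "f (x + 16 + s) * g (x + 16 + t) = f (x + s) * g (x + t)"
  using antiperiodic_mult_periodic[OF assms, of "x + s" "x + t"] by (simp add: algebra_simps)

lemma autocorr_minus:
  assumes "antiperiodic a"
  shows "autocorr a (- d) = autocorr a d"
proof -
  have "(\<Sum>x\<in>I16. a (x + d) * a (x + d - d)) = (\<Sum>x\<in>I16. a x * a (x - d))"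
    using sum_periodic_shift[of "\<lambda>x. a x * a (x - d)" d]
      antiperiodic_mult_shift[OF assms assms, of _ 0 "- d"] by simp
  then show ?thesis by (simp add: autocorr_def mult.commute)
qed

lemma autocorr_shift:
  assumes "antiperiodic a"
  shows "autocorr (\<lambda>x. a (x + t)) d = autocorr a d"
  using sum_periodic_shift[of "\<lambda>x. a x * a (x + d)" t]
    antiperiodic_mult_shift[OF assms assms, of _ 0 d] by (simp add: autocorr_def add_ac)

lemma autocorr_dilate:
  assumes "antiperiodic a" "odd u"
  shows "autocorr (\<lambda>x. a (u * x)) d = autocorr a (u * d)"
  using sum_periodic_dilate[of "\<lambda>x. a x * a (x + u * d)" u]
    antiperiodic_mult_shift[OF assms(1,1), of _ 0 "u * d"] assms(2) by (simp add: autocorr_def algebra_simps)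

lemma abs_autocorr_le:
  assumes "sign_seq a"
  shows "\<bar>autocorr a d\<bar> \<le> 16"
proof -
  have "\<bar>autocorr a d\<bar> \<le> (\<Sum>x\<in>I16. \<bar>a x * a (x + d)\<bar>)"
    unfolding autocorr_def by (rule sum_abs)
  also have "\<dots> = (\<Sum>x\<in>I16. 1)"
  proof (rule sum.cong[OF refl])
    fix x
    show "\<bar>a x * a (x + d)\<bar> = 1"
    proof -
      have "a x = 1 \<or> a x = - 1" "a (x + d) = 1 \<or> a (x + d) = - 1"
        using assms by (auto simp: sign_seq_def)
      then show ?thesis by (elim disjE) simp_all
    qed
  qed
  finally show ?thesis by simp
qed

definition energy :: "(int \<Rightarrow> int) \<Rightarrow> int" where
  "energy a = (\<Sum>d\<in>I16. (autocorr a d)\<^sup>2)"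

lemma I16_eq: "I16 = {0,1,2,3,4,5,6,7,8,9,10,11,12,13,14,15}"
  by (rule set_eqI) (simp, presburger)

lemma sum_I16: "sum f I16 = f 0 + f 1 + f 2 + f 3 + f 4 + f 5 + f 6 + f 7 + f 8 + f 9 + f 10 + f 11 + f 12
  + f 13 + f 14 + (f 15 :: 'a::comm_monoid_add)"
  unfolding I16_eq by (simp add: add.assoc)

lemma energy_dilate:
  assumes "antiperiodic a" "odd u"
  shows "energy (\<lambda>x. a (u * x)) = energy a"
proof -
  have "(\<Sum>d\<in>I16. (autocorr a (u * d))\<^sup>2) = energy a"
    unfolding energy_def
    by (rule sum_periodic_dilate[of "\<lambda>d. (autocorr a d)\<^sup>2"])
       (use assms in \<open>auto simp: antiperiodicD[OF antiperiodic_autocorr]\<close>)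
  then show ?thesis by (simp add: energy_def autocorr_dilate assms)
qed

section \<open>Sign sequences with large autocorrelation energy\<close>

lemma I8: "{0..<8} = {0,1,2,3,4,5,6,7::int}"
  by (rule set_eqI) (simp, presburger)

text \<open>Checked on all 256 sign patterns. The constant pattern attains the bound: 64 + 2 * (36 +
  16 + 4) = 176.\<close>

lemma eight_bound:
  fixes f :: "int \<Rightarrow> int"
  assumes per: "\<And>x. f (x + 8) = - f x" and pm: "\<And>x. f x = 1 \<or> f x = - 1"
  shows "(\<Sum>k\<in>{0..<8}. (\<Sum>x\<in>{0..<8}. f x * f (x + k))\<^sup>2) \<le> 176"
proof -
  have e: "f 8 = - f 0" "f 9 = - f 1" "f 10 = - f 2" "f 11 = - f 3" "f 12 = - f 4" "f 13 = - f 5" "f 14 = - f 6"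
    using per[of 0] per[of 1] per[of 2] per[of 3] per[of 4] per[of 5] per[of 6] by simp_all
  show ?thesis
    using pm[of 0] pm[of 1] pm[of 2] pm[of 3] pm[of 4] pm[of 5] pm[of 6] pm[of 7]
    by (elim disjE) (simp_all add: I8 e)
qed

text \<open>An even lag does not mix even and odd positions, so the autocorrelation is the sum of
  those of two sequences with antiperiod 8, and the square of a sum is at most twice the sum of the
  squares.\<close>

lemma even_energy:
  assumes "sign_seq a"
  shows "(\<Sum>k\<in>{0..<8}. (autocorr a (2 * k))\<^sup>2) \<le> 704"
proof -
  define e o' where "e = (\<lambda>x. a (2 * x))" and "o' = (\<lambda>x. a (2 * x + 1))"
  have ap: "antiperiodic a" and pm: "\<And>x. a x = 1 \<or> a x = - 1" using assms by (auto simp: sign_seq_def)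
  let ?r = "\<lambda>f k. \<Sum>x\<in>{0..<8}. f x * f (x + k) :: int"
  have split: "autocorr a (2 * k) = ?r e k + ?r o' k" for k
    unfolding autocorr_def sum_I16 I8 e_def o'_def by (simp add: algebra_simps)
  have per: "e (x + 8) = - e x" "o' (x + 8) = - o' x" for x
    using antiperiodicD[OF ap, of "2 * x"] antiperiodicD[OF ap, of "2 * x + 1"]
    by (auto simp: e_def o'_def algebra_simps)
  have "(\<Sum>k\<in>{0..<8}. (autocorr a (2 * k))\<^sup>2) \<le> (\<Sum>k\<in>{0..<8}. 2 * (?r e k)\<^sup>2 + 2 * (?r o' k)\<^sup>2)"
  proof (rule sum_mono)
    fix k :: int
    have "(?r e k + ?r o' k)\<^sup>2 + (?r e k - ?r o' k)\<^sup>2 = 2 * (?r e k)\<^sup>2 + 2 * (?r o' k)\<^sup>2"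
      by (simp add: power2_eq_square algebra_simps)
    moreover have "0 \<le> (?r e k - ?r o' k)\<^sup>2" by simp
    ultimately show "(autocorr a (2 * k))\<^sup>2 \<le> 2 * (?r e k)\<^sup>2 + 2 * (?r o' k)\<^sup>2"
      unfolding split by linarith
  qed
  also have "\<dots> = 2 * (\<Sum>k\<in>{0..<8}. (?r e k)\<^sup>2) + 2 * (\<Sum>k\<in>{0..<8}. (?r o' k)\<^sup>2)"
    by (simp add: sum.distrib sum_distrib_left)
  also have "\<dots> \<le> 2 * 176 + 2 * 176"
    using eight_bound[of e] eight_bound[of o'] per pm by (auto simp: e_def o'_def)
  finally show ?thesis by simp
qed

text \<open>The lag \<open>16 - d\<close> is odd as well and carries the opposite value, so the
  one-sided hypothesis bounds absolute values, and 704 + 8 * 25 = 904. Contrapositively, an energy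
  above 928 forces an odd lag with autocorrelation at least 6.\<close>

lemma energy_le:
  assumes "sign_seq a" and small: "\<And>d. d \<in> {1,3,5,7,9,11,13,15} \<Longrightarrow> autocorr a d \<le> 5"
  shows "energy a \<le> 904"
proof -
  have ap: "antiperiodic a" using assms by (auto simp: sign_seq_def)
  have rev: "autocorr a (16 - d) = - autocorr a d" for d
    using antiperiodicD[OF antiperiodic_autocorr[OF ap], of "- d"] autocorr_minus[OF ap, of d] by (simp add: add.commute)
  have sq: "(autocorr a d)\<^sup>2 \<le> 25" if "d \<in> {1,3,5,7,9,11,13,15}" for d
  proof -
    have "autocorr a d \<le> 5" using small that by blast
    moreover have "autocorr a (16 - d) \<le> 5" by (rule small) (use that in auto)
    ultimately have "\<bar>autocorr a d\<bar> \<le> 5" using rev[of d] by linarith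
    then show ?thesis using power_mono[of "\<bar>autocorr a d\<bar>" 5 2] by simp
  qed
  show ?thesis
    using even_energy[OF assms(1)] sq[of 1] sq[of 3] sq[of 5] sq[of 7] sq[of 9] sq[of 11] sq[of 13] sq[of 15]
    unfolding energy_def sum_I16 I8 by simp
qed

text \<open>The sequence that is constant on \<open>{0..<16}\<close> except at \<open>p\<close>; \<open>p = 16\<close> encodes no exception.\<close>

definition base_seq :: "int \<Rightarrow> int \<Rightarrow> int" where
  "base_seq p x = (if x mod 16 = p then - 1 else 1) * (if even (x div 16) then 1 else - 1)"

section \<open>Exhaustive search over sign patterns with few sign changes\<close>

fun agreement :: "bool list \<Rightarrow> bool list \<Rightarrow> int" where
  "agreement (x # xs) (y # ys) =
    (if x then (if y then agreement xs ys + 1 else agreement xs ys - 1)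
     else (if y then agreement xs ys - 1 else agreement xs ys + 1))"
| "agreement [] ys = 0"
| "agreement (x # xs) [] = 0"

definition square :: "int \<Rightarrow> int" where "square x = x * x"

text \<open>The patterns that pass none of the numerical tests in \<open>good_signs\<close>;
  \<open>exceptional_eq\<close> recognises each of them as a shifted base sequence.\<close>

definition exceptional :: "bool list list" where "exceptional = [
    [True, True, True, True, True, True, True, True, True, True, True, True, True, True, True, True],
    [True, False, True, True, True, True, True, True, True, True, True, True, True, True, True, True],
    [True, False, False, False, False, False, False, False, False, False, False, False, False, False, False, True],
    [True, True, True, True, True, True, True, True, True, True, True, True, True, True, False, True],
    [True, False, False, True, True, True, True, True, True, True, True, True, True, True, True, True],
    [True, False, False, False, False, False, False, False, False, False, False, False, False, False, True, True],
    [True, True, False, True, True, True, True, True, True, True, True, True, True, True, True, True],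
    [True, True, False, False, False, False, False, False, False, False, False, False, False, False, False, True],
    [True, True, True, True, True, True, True, True, True, True, True, True, True, False, True, True],
    [True, True, True, True, True, True, True, True, True, True, True, True, True, False, False, True]]"

text \<open>
  Since \<open>r 0 = 16\<close>, \<open>r 8 = 0\<close> and \<open>r (16 - d) = - r d\<close>, a sum of squares of \<open>r 1, ..., r 7\<close> up to 336 means
  an energy of at most \<open>256 + 2 * 336 = 928\<close>. The other alternatives in terms of \<open>r\<close> discard sequences for which
  some odd dilation has a larger \<open>r 1\<close>, or the same \<open>r 1\<close> and a larger \<open>r 3\<close>.
\<close>

definition good_signs :: "bool list \<Rightarrow> bool" where
  "good_signs l \<longleftrightarrow> (let e = l @ map Not l;
     r1 = agreement l (drop 1 e); r3 = agreement l (drop 3 e) in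
   r1 < \<bar>r3\<bar> \<or> (let r5 = agreement l (drop 5 e) in
   r1 < \<bar>r5\<bar> \<or> r5 = - r1 \<and> r3 < r1 \<or> (let r7 = agreement l (drop 7 e) in
   r1 < \<bar>r7\<bar> \<or>
   square r1 + square r3 + square r5 + square r7 + square (agreement l (drop 2 e))
     + square (agreement l (drop 4 e)) + square (agreement l (drop 6 e)) \<le> 336 \<or>
   List.member exceptional l)))"

text \<open>Patterns grow from the last entry towards the first, \<open>b\<close> being the current
  front entry and \<open>c\<close> the number of changes still allowed. Finished patterns that start
  with \<open>False\<close> are accepted untested.\<close>

fun search :: "nat \<Rightarrow> nat \<Rightarrow> bool \<Rightarrow> bool list \<Rightarrow> bool" where
  "search 0 c b l = (if b then good_signs l else True)"
| "search (Suc n) c b l = (search n c b (b # l) \<and>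
     (case c of 0 \<Rightarrow> True | Suc c' \<Rightarrow> search n c' (\<not> b) ((\<not> b) # l)))"

fun changes :: "bool list \<Rightarrow> nat" where
  "changes (x # y # l) = changes (y # l) + (if x = y then 0 else 1)"
| "changes l = 0"

lemma search_sound:
  "search n c b (b # l) \<Longrightarrow> length xs = n \<Longrightarrow> changes (xs @ b # l) \<le> c + changes (b # l)
    \<Longrightarrow> hd (xs @ b # l) \<Longrightarrow> good_signs (xs @ b # l)"
proof (induction n arbitrary: c b l xs)
  case 0
  then show ?case by simp
next
  case (Suc n)
  then obtain ys y where xs: "xs = ys @ [y]" and len: "length ys = n"
    by (metis length_Suc_conv_rev)
  \<comment> \<open>Prepending entries never lowers the number of changes, so a change at the front
    is possible only while the budget \<open>c\<close> is positive.\<close>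
  have mono: "changes (y # b # l) \<le> changes (zs @ y # b # l)" for zs
  proof (induction zs)
    case (Cons z zs) then show ?case by (cases "zs @ y # b # l") auto
  qed simp
  show ?case
  proof (cases "y = b")
    case True
    have "good_signs (ys @ b # b # l)"
    proof (rule Suc.IH)
      show "search n c b (b # b # l)" using Suc.prems(1) by simp
    qed (use Suc.prems len in \<open>simp_all add: xs True\<close>)
    then show ?thesis by (simp add: xs True)
  next
    case False
    with mono[of ys] Suc.prems(3) obtain c' where c: "c = Suc c'"
      by (cases c) (auto simp: xs)
    have y: "y = (\<not> b)" using False by simp
    have "good_signs (ys @ (\<not> b) # b # l)"
    proof (rule Suc.IH)
      show "search n c' (\<not> b) ((\<not> b) # b # l)" using Suc.prems(1) by (simp add: c)
    qed (use Suc.prems len False in \<open>simp_all add: xs y c\<close>)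
    then show ?thesis by (simp add: xs y)
  qed
qed

lemma agreement_nth:
  "length l \<le> length m \<Longrightarrow> agreement l m = (\<Sum>i<length l. if l ! i = m ! i then 1 else - 1)"
proof (induction l m rule: agreement.induct)
  case (1 x xs y ys)
  have "(\<Sum>i<length (x # xs). if (x # xs) ! i = (y # ys) ! i then 1 else - 1 :: int)
    = (if x = y then 1 else - 1) + (\<Sum>i<length xs. if xs ! i = ys ! i then 1 else - 1)"
    by (simp add: sum.lessThan_Suc_shift del: sum.lessThan_Suc)
  with 1 show ?case by auto
qed auto

text \<open>At lag 1 every sign change costs 2, and the last entry is compared with the first one of
  the continuation. A lower bound on the autocorrelation at lag 1 thus caps the number of
  changes.\<close>

lemma agreement_changes:
  "l \<noteq> [] \<Longrightarrow> agreement l (tl l @ y # m)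
    = int (length l) - 2 * int (changes l) - (if last l = y then 0 else 2)"
  by (induction l rule: changes.induct) auto

definition sign_list :: "(int \<Rightarrow> int) \<Rightarrow> bool list" where
  "sign_list a = map (\<lambda>i. a i = 1) [0..15]"

lemma sum_int_nat: "(\<Sum>x\<in>I16. f x) = (\<Sum>i<16::nat. f (int i))"
  unfolding sum_I16 by (simp add: numeral_eq_Suc add_ac)

lemma length_sign_list [simp]: "length (sign_list a) = 16"
  by (simp add: sign_list_def)

lemma sign_list_nth: "i < 16 \<Longrightarrow> sign_list a ! i \<longleftrightarrow> a (int i) = 1"
  by (simp add: sign_list_def nth_upto)

lemma agreement_autocorr:
  assumes "sign_seq a" "d \<le> 16"
  shows "agreement (sign_list a) (drop d (sign_list a @ map Not (sign_list a))) = autocorr a (int d)"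
proof -
  have ap: "antiperiodic a" and pm: "\<And>x. a x = 1 \<or> a x = - 1" using assms by (auto simp: sign_seq_def)
  have e: "(sign_list a @ map Not (sign_list a)) ! i \<longleftrightarrow> a (int i) = 1" if "i < 32" for i
  proof (cases "i < 16")
    case False
    then have "(sign_list a @ map Not (sign_list a)) ! i \<longleftrightarrow> \<not> a (int i - 16) = 1"
      using that by (simp add: nth_append sign_list_nth of_nat_diff)
    then show ?thesis using antiperiodic_minus[OF ap, of "int i"] pm[of "int i"] by auto
  qed (simp add: nth_append sign_list_nth)
  have "agreement (sign_list a) (drop d (sign_list a @ map Not (sign_list a)))
    = (\<Sum>i<16. if sign_list a ! i = drop d (sign_list a @ map Not (sign_list a)) ! i then 1 else - 1)"
    using assms(2) by (subst agreement_nth) auto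
  also have "\<dots> = (\<Sum>i<16. a (int i) * a (int i + int d))"
  proof (rule sum.cong[OF refl])
    fix i assume i: "i \<in> {..<16::nat}"
    with assms(2) have "drop d (sign_list a @ map Not (sign_list a)) ! i \<longleftrightarrow> a (int i + int d) = 1"
      using e[of "d + i"] by (simp add: add.commute del: drop_append)
    with i show "(if sign_list a ! i = drop d (sign_list a @ map Not (sign_list a)) ! i then 1 else - 1)
        = a (int i) * a (int i + int d)"
      using pm[of "int i"] pm[of "int i + int d"] by (auto simp: sign_list_nth simp del: drop_append)
  qed
  finally show ?thesis by (simp add: autocorr_def sum_int_nat)
qed

text \<open>The last entry is fixed to \<open>True\<close> and 15 remain. The tested patterns also
  start with \<open>True\<close>, so they have 0, 2 or 4 changes: 1 + 105 + 1365 patterns instead of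
  all sign patterns of length 16.\<close>

lemma search_holds: "search 15 4 True [True]"
  by code_simp

definition exceptional_params :: "(int \<times> int) list" where
  "exceptional_params = [(16, 0), (1, 0), (1, 17), (1, 2), (13, 29), (2, 18), (2, 0), (13, 14), (13, 0), (2, 3)]"

lemma exceptional_eq: "exceptional = map (\<lambda>(p, t). sign_list (\<lambda>x. base_seq p (x + t))) exceptional_params"
  by code_simp

lemma antiperiodic_base_seq: "antiperiodic (base_seq p)"
  by (auto simp: antiperiodic_def base_seq_def)

lemma sign_seq_base_seq: "sign_seq (base_seq p)"
  using antiperiodic_base_seq by (auto simp: sign_seq_def base_seq_def)

lemma sign_seq_dilate: "sign_seq a \<Longrightarrow> odd u \<Longrightarrow> sign_seq (\<lambda>x. a (u * x))"
  using antiperiodic_dilate[of a u] by (auto simp: sign_seq_def)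

lemma sign_seq_shift: "sign_seq a \<Longrightarrow> sign_seq (\<lambda>x. a (x + t))"
  using antiperiodic_shift[of a t] by (auto simp: sign_seq_def)

lemma sign_seq_eqI:
  assumes "sign_seq a" "sign_seq b" "sign_list a = sign_list b"
  shows "a x = b x"
proof (rule antiperiodic_eqI[of a b])
  show "antiperiodic a" "antiperiodic b" using assms by (auto simp: sign_seq_def)
  fix x assume "x \<in> I16"
  then have "a x = 1 \<longleftrightarrow> b x = 1"
    using assms(3) sign_list_nth[of "nat x" a] sign_list_nth[of "nat x" b] by auto
  moreover have "a x = 1 \<or> a x = - 1" "b x = 1 \<or> b x = - 1" using assms by (auto simp: sign_seq_def)
  ultimately show "a x = b x" by auto
qed

text \<open>Otherwise the value 1 would propagate backwards step by step through a half period and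
  contradict antiperiodicity. Shifting by \<open>s\<close> normalises the window so that its first
  and last entries are positive.\<close>

lemma sign_seq_upcrossing:
  assumes "sign_seq a"
  obtains s where "a s = 1" "a (s + 15) = 1"
proof (rule ccontr)
  assume "\<not> thesis"
  with that have no: "a (s + 15) \<noteq> 1" if "a s = 1" for s using that by blast
  have ap: "antiperiodic a" and pm: "\<And>x. a x = 1 \<or> a x = - 1" using assms by (auto simp: sign_seq_def)
  have down: "a (s - 1) = 1" if "a s = 1" for s
    using no[OF that] pm[of "s + 15"] antiperiodicD[OF ap, of "s - 1"] by (simp add: algebra_simps)
  have "a (s - int n) = 1" if "a s = 1" for s n
  proof (induction n)
    case (Suc n) then show ?case using down[of "s - int n"] by (simp add: algebra_simps)
  qed (simp add: that)
  from this[of _ 16] have "a (s - 16) = 1" if "a s = 1" for s using that by simp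
  then have "a s \<noteq> 1" for s using antiperiodic_minus[OF ap, of s] by force
  then show False using pm[of 0] antiperiodicD[OF ap, of 0] by (metis minus_minus)
qed

definition units :: "int set" where "units = {1, 3, 5, 7, 9, 11, 13, 15}"

text \<open>The odd residues modulo 32 are, up to sign, the eight elements of \<open>units\<close>;
  autocorrelations are even, so these represent all dilations.\<close>

lemma odd_reduce:
  assumes "odd d"
  obtains d' s where "d' \<in> units" "s = 1 \<or> s = - (1::int)" "(s * d') mod 32 = d mod 32"
proof -
  have odd: "odd (d mod 32)" using assms by (simp add: dvd_mod_iff)
  have "d mod 32 \<in> I16 \<or> 32 - d mod 32 \<in> {0..<17}" by auto
  then have "d mod 32 \<in> units \<or> (- d) mod 32 \<in> units"
  proof
    assume "d mod 32 \<in> I16"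
    then show ?thesis using odd unfolding I16_eq units_def insert_iff empty_iff by (elim disjE) simp_all
  next
    assume "32 - d mod 32 \<in> {0..<17}"
    moreover have "odd (32 - d mod 32)" using odd by simp
    ultimately have "32 - d mod 32 \<in> I16" by (cases "32 - d mod 32 = 16") (simp, auto)
    then have "32 - d mod 32 \<in> units"
      using \<open>odd (32 - d mod 32)\<close> unfolding I16_eq units_def insert_iff empty_iff by (elim disjE) simp_all
    moreover have "(- d) mod 32 = 32 - d mod 32"
      using odd by (auto simp: zmod_zminus1_eq_if)
    ultimately show ?thesis by simp
  qed
  then show ?thesis
  proof
    assume "d mod 32 \<in> units" then show ?thesis using that[of "d mod 32" 1] by simp
  next
    assume "(- d) mod 32 \<in> units"
    then show ?thesis using that[of "(- d) mod 32" "- 1"] by (simp add: mod_minus_eq)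
  qed
qed

text \<open>Dilations permute the autocorrelation values, so the sequence is first dilated to make
  the value at lag 1 as large as possible. By \<open>energy_le\<close> it is then at least 6, which
  leaves at most four sign changes and brings the sequence within reach of the search.\<close>

lemma energy_classification:
  assumes a: "sign_seq a" and large: "energy a > 928"
  obtains u p t where "u \<in> units" "p \<in> {16, 1, 2, 13}" "\<And>x. a (u * x) = base_seq p (x + t)"
proof -
  have ap: "antiperiodic a" using a by (simp add: sign_seq_def)
  \<comment> \<open>A lexicographic order in one integer: values at lag \<open>3 * d\<close> differ
    by at most 32, so the factor 100 lets the value at lag \<open>d\<close> decide and the other
    only breaks ties.\<close>
  define M where "M = (\<lambda>d. 100 * autocorr a d + autocorr a (3 * d))"
  have "finite units" "units \<noteq> {}" by (simp_all add: units_def)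
  then obtain u where u: "u \<in> units" and umax: "\<And>d. d \<in> units \<Longrightarrow> M d \<le> M u"
    using Max_in[of "M ` units"] Max_ge[of "M ` units"] by (metis (no_types, lifting) finite_imageI image_iff image_is_empty imageI)
  have oddu: "odd u" using u by (auto simp: units_def)
  have M_le: "M d \<le> M u" if odd: "odd d" for d
  proof -
    obtain d' s where d': "d' \<in> units" "s = 1 \<or> s = - (1::int)" "(s * d') mod 32 = d mod 32"
      using odd by (rule odd_reduce)
    have eq: "autocorr a (k * d) = autocorr a (k * d')" for k
    proof -
      have "(k * (s * d')) mod 32 = (k * d) mod 32" using d'(3) by (metis mod_mult_right_eq)
      then have "autocorr a (k * d) = autocorr a (k * (s * d'))"
        by (intro antiperiodic_cong[OF antiperiodic_autocorr[OF ap]]) simp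
      then show ?thesis using d'(2) autocorr_minus[OF ap, of "k * d'"] by auto
    qed
    have "M d = M d'" using eq[of 1] eq[of 3] by (simp add: M_def)
    with umax d'(1) show ?thesis by simp
  qed
  obtain d0 where d0: "odd d0" "autocorr a d0 \<ge> 6"
  proof (rule ccontr)
    assume "\<not> thesis"
    with that have no: "autocorr a d \<le> 5" if "odd d" for d using that by force
    have "energy a \<le> 904" by (rule energy_le[OF a]) (rule no, auto)
    with large show False by simp
  qed
  define b where "b = (\<lambda>x. a (u * x))"
  have b: "sign_seq b" using sign_seq_dilate[OF a oddu] by (simp add: b_def)
  then have bp: "antiperiodic b" by (simp add: sign_seq_def)
  have ab: "autocorr b d = autocorr a (u * d)" for d
    unfolding b_def by (rule autocorr_dilate[OF ap oddu])
  have b1: "autocorr b 1 \<ge> 6"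
    using M_le[OF d0(1)] d0(2) abs_autocorr_le[OF a, of "3 * d0"] abs_autocorr_le[OF a, of "3 * u"]
    by (simp add: M_def ab)
  have Mb: "100 * autocorr b d + autocorr b (3 * d) \<le> 100 * autocorr b 1 + autocorr b 3" if "odd d" for d
    using M_le[of "u * d"] that oddu by (simp add: M_def ab algebra_simps)
  obtain s where s: "b s = 1" "b (s + 15) = 1" using sign_seq_upcrossing[OF b] .
  define c where "c = (\<lambda>x. b (x + s))"
  have c: "sign_seq c" unfolding c_def by (rule sign_seq_shift[OF b])
  have ac: "autocorr c d = autocorr b d" for d
    unfolding c_def by (rule autocorr_shift[OF bp])
  have apr: "autocorr b (d + 16) = - autocorr b d" "autocorr b (d + 32) = autocorr b d"
    "autocorr b (- d) = autocorr b d" for d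
    using antiperiodicD[OF antiperiodic_autocorr[OF bp]] autocorr_minus[OF bp]
      antiperiodic_cong[OF antiperiodic_autocorr[OF bp], of "d + 32" d] by auto
  have refl: "autocorr b 8 = 0" "autocorr b 9 = - autocorr b 7" "autocorr b 10 = - autocorr b 6"
    "autocorr b 11 = - autocorr b 5" "autocorr b 12 = - autocorr b 4" "autocorr b 13 = - autocorr b 3"
    "autocorr b 14 = - autocorr b 2" "autocorr b 15 = - autocorr b 1" "autocorr b 21 = - autocorr b 5"
    "autocorr b 27 = autocorr b 5" "autocorr b 33 = autocorr b 1" "autocorr b 39 = autocorr b 7"
    using apr(1)[of "-8"] apr(1)[of "-7"] apr(1)[of "-6"] apr(1)[of "-5"] apr(1)[of "-4"] apr(1)[of "-3"]
      apr(1)[of "-2"] apr(1)[of "-1"] apr(3)[of 8] apr(3)[of 7] apr(3)[of 6] apr(3)[of 5] apr(3)[of 4]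
      apr(3)[of 3] apr(3)[of 2] apr(3)[of 1] apr(1)[of 5] apr(2)[of "-5"] apr(2)[of 1] apr(2)[of 7]
    by simp_all
  have r0: "autocorr b 0 = 16"
  proof -
    have "b x * b x = 1" for x
    proof -
      have "b x = 1 \<or> b x = - 1" using b by (simp add: sign_seq_def)
      then show ?thesis by auto
    qed
    then show ?thesis by (simp add: autocorr_def)
  qed
  have "energy b > 928" unfolding b_def using large by (simp add: energy_dilate[OF ap oddu])
  then have energy: "square (autocorr b 1) + square (autocorr b 3) + square (autocorr b 5)
      + square (autocorr b 7) + square (autocorr b 2) + square (autocorr b 4) + square (autocorr b 6) > 336"
    unfolding energy_def sum_I16 refl r0 square_def by (simp add: power2_eq_square)
  let ?l = "sign_list c"
  have agr: "agreement ?l (drop d (?l @ map Not ?l)) = autocorr b (int d)" if "d \<le> 16" for d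
    using agreement_autocorr[OF c that] by (simp add: ac)
  have l_def: "?l = map (\<lambda>i. c i = 1) ([0..14]) @ [True]"
    using s(2) by (simp add: sign_list_def c_def upto_rec1 add.commute)
  define xs where "xs = map (\<lambda>i. c i = 1) [0..14]"
  have lxs: "?l = xs @ [True]" "length xs = 15" using l_def by (simp_all add: xs_def)
  have hd: "hd ?l" using s(1) by (simp add: sign_list_def c_def upto_rec1)
  have "changes ?l \<le> 4"
  proof -
    have ne: "?l \<noteq> []" unfolding lxs by simp
    obtain ys where ys: "?l = True # ys"
      using hd ne by (metis (full_types) list.collapse)
    then have "drop 1 (?l @ map Not ?l) = tl ?l @ False # map Not ys" by simp
    moreover have "last ?l" unfolding lxs by simp
    \<comment> \<open>The final \<open>- 2\<close> is the change from position 15 to position 16,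
      forced by the normalised window; \<open>b1\<close> then leaves at most four changes inside
      it.\<close>
    ultimately have "autocorr b 1 = 16 - 2 * int (changes ?l) - 2"
      using agr[of 1] agreement_changes[OF ne, of False "map Not ys"] by (simp del: drop_append)
    with b1 show ?thesis by simp
  qed
  then have "good_signs (xs @ [True])"
    using search_sound[OF search_holds lxs(2)] hd unfolding lxs by simp
  then have good: "good_signs ?l" by (simp add: lxs)
  have bnd: "\<bar>autocorr b d\<bar> \<le> 16" for d using abs_autocorr_le[OF b] .
  \<comment> \<open>Maximality is used at the two odd lags \<open>d\<close> and
    \<open>16 - d\<close>, whose autocorrelations are opposite; together they bound the absolute
    value.\<close>
  have r3: "\<bar>autocorr b 3\<bar> \<le> autocorr b 1"
    using Mb[of 3] Mb[of 13] bnd[of 1] bnd[of 3] bnd[of 7] refl by simp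
  have r5: "\<bar>autocorr b 5\<bar> \<le> autocorr b 1"
    using Mb[of 5] Mb[of 11] bnd[of 1] bnd[of 3] bnd[of 5] refl by simp
  have r7: "\<bar>autocorr b 7\<bar> \<le> autocorr b 1"
    using Mb[of 7] Mb[of 9] bnd[of 1] bnd[of 3] bnd[of 5] refl by simp
  \<comment> \<open>If lag 11 ties with lag 1, the tie-break compares lag 33, which is lag 1 again,
    with lag 3.\<close>
  have r5': "\<not> (autocorr b 5 = - autocorr b 1 \<and> autocorr b 3 < autocorr b 1)"
    using Mb[of 11] refl by simp
  have "?l \<in> set exceptional"
    using good energy r3 r5 r7 r5' agr[of 1] agr[of 2] agr[of 3] agr[of 4] agr[of 5] agr[of 6] agr[of 7]
    unfolding good_signs_def Let_def by (simp del: drop_append, blast)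
  then obtain p t where pt: "(p, t) \<in> set exceptional_params" "?l = sign_list (\<lambda>x. base_seq p (x + t))"
    unfolding exceptional_eq by auto
  have "c x = base_seq p (x + t)" for x
    by (rule sign_seq_eqI[OF c sign_seq_shift[OF sign_seq_base_seq] pt(2)])
  then have "b x = base_seq p (x - s + t)" for x
    using c_def by (metis diff_add_cancel)
  then have "a (u * x) = base_seq p (x + (t - s))" for x
    by (simp add: b_def add_diff_eq diff_add_eq add.commute)
  moreover have "p \<in> {16, 1, 2, 13}" using pt(1) by (auto simp: exceptional_params_def)
  ultimately show ?thesis using that u by blast
qed

section \<open>The Bell functional on the exceptional sequences\<close>

text \<open>
  The coefficients of the cosines in the formula for \<^const>\<open>v16_GHZ3\<close>, cleared of denominators by the factor
  \<open>7815616278 = 822 * 9508049\<close>. The local bound is \<open>2000797767168 = 256 * 7815616278\<close>.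
\<close>

definition dual_list :: "int list" where
  "dual_list = [3907808139, 4915849344, -3422897640, 6337527936, 2605205426, -2241495360, -1597352232,
     -4709652288, 0, 4709652288, 1597352232, 2241495360, -2605205426, -6337527936, 3422897640, -4915849344]"

definition dual :: "int \<Rightarrow> int" where
  "dual x = (dual_list @ map uminus dual_list) ! nat (x mod 32)"

lemma nth_append_uminus:
  "length l = 16 \<Longrightarrow> i < 16 \<Longrightarrow> (l @ map uminus l) ! (i + 16) = - (l ! i :: int)"
  "length l = 16 \<Longrightarrow> i < 16 \<Longrightarrow> (l @ map uminus l) ! i = l ! i"
  by (simp_all add: nth_append)

lemma antiperiodic_dual: "antiperiodic dual"
  unfolding antiperiodic_def
proof
  fix x :: int
  have len: "length dual_list = 16" by (simp add: dual_list_def)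
  have "x mod 32 < 16 \<and> (x + 16) mod 32 = x mod 32 + 16 \<or> x mod 32 \<ge> 16 \<and> (x + 16) mod 32 = x mod 32 - 16"
  proof (cases "x mod 32 < 16")
    case True
    then have "(x mod 32 + 16) mod 32 = x mod 32 + 16" by (intro mod_pos_pos_trivial) auto
    with True show ?thesis by (simp add: mod_add_left_eq)
  next
    case False
    moreover have "x mod 32 < 32" by simp
    ultimately have "(x mod 32 - 16) mod 32 = x mod 32 - 16" by (intro mod_pos_pos_trivial) auto
    moreover have "(x + 16) mod 32 = (x mod 32 + 16) mod 32" by (simp add: mod_add_left_eq)
    moreover have "\<dots> = (x mod 32 - 16) mod 32" using mod_add_self2[of "x mod 32 - 16" 32] by (simp add: add.commute)
    ultimately show ?thesis using False by simp
  qed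
  then consider "x mod 32 < 16" "(x + 16) mod 32 = x mod 32 + 16" | "x mod 32 \<ge> 16" "(x + 16) mod 32 = x mod 32 - 16"
    by blast
  then show "dual (x + 16) = - dual x"
  proof cases
    case 1
    then have "nat ((x + 16) mod 32) = nat (x mod 32) + 16" by (simp add: nat_add_distrib)
    then show ?thesis using 1 nth_append_uminus[OF len, of "nat (x mod 32)"] by (simp add: dual_def)
  next
    case 2
    then have "nat (x mod 32) = nat ((x + 16) mod 32) + 16" by (simp add: nat_diff_distrib)
    moreover have "nat ((x + 16) mod 32) < 16" using 2 by (simp add: nat_less_iff)
    ultimately show ?thesis using nth_append_uminus[OF len, of "nat ((x + 16) mod 32)"] by (simp add: dual_def)
  qed
qed

definition seq_list :: "(int \<Rightarrow> int) \<Rightarrow> int list" where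
  "seq_list f = map f [0..15]"

text \<open>Convolution with a base sequence needs only running sums, which keeps the exact evaluation cheap.\<close>

fun window :: "int \<Rightarrow> int list \<Rightarrow> int list" where
  "window s [] = []"
| "window s (y # ys) = s # window (s - (y + y)) ys"

definition base_sum :: "int \<Rightarrow> int list \<Rightarrow> int list" where
  "base_sum p f = (let g = window (sum_list f) f in
     if p = 16 then g else map2 (\<lambda>x y. x - (y + y)) g (drop (nat p) (f @ map uminus f)))"

lemma window_seq:
  assumes "\<And>z. g (z + 1) = g z - 2 * f z"
  shows "window (g k) (map f [k..k + int n - 1]) = map g [k..k + int n - 1]"
proof (induction n arbitrary: k)
  case (Suc n)
  have "[k..k + int (Suc n) - 1] = k # [k + 1..k + 1 + int n - 1]"
    by (simp add: upto_rec1 algebra_simps)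
  then show ?case using Suc[of "k + 1"] assms[of k] by simp
qed simp

definition base_conv :: "int \<Rightarrow> (int \<Rightarrow> int) \<Rightarrow> int \<Rightarrow> int" where
  "base_conv p f z = (\<Sum>x\<in>I16. base_seq p x * f (x + z))"

lemma base_seq_I16: "x \<in> I16 \<Longrightarrow> base_seq p x = (if x = p then - 1 else 1)"
  by (simp add: base_seq_def)

lemma base_conv_eq:
  assumes "p \<in> {16, 1, 2, 13}"
  shows "base_conv p f z = (\<Sum>x\<in>I16. f (x + z)) - (if p = 16 then 0 else 2 * f (p + z))"
proof -
  have "base_conv p f z = (\<Sum>x\<in>I16. f (x + z) - (if x = p then 2 * f (x + z) else 0))"
    unfolding base_conv_def by (intro sum.cong) (auto simp: base_seq_I16)
  also have "\<dots> = (\<Sum>x\<in>I16. f (x + z)) - (\<Sum>x\<in>I16. if x = p then 2 * f (x + z) else 0)"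
    by (rule sum_subtractf)
  also have "(\<Sum>x\<in>I16. if x = p then 2 * f (x + z) else 0) = (if p \<in> I16 then 2 * f (p + z) else 0)"
    by (rule sum.delta) simp
  finally show ?thesis using assms by auto
qed

lemma seq_list_nth: "i < 16 \<Longrightarrow> seq_list f ! i = f (int i)"
  by (simp add: seq_list_def nth_upto)

lemma length_seq_list [simp]: "length (seq_list f) = 16"
  by (simp add: seq_list_def)

lemma seq_list_append_nth:
  assumes "antiperiodic f" "i < 32"
  shows "(seq_list f @ map uminus (seq_list f)) ! i = f (int i)"
proof (cases "i < 16")
  case False
  then have "(seq_list f @ map uminus (seq_list f)) ! i = - f (int i - 16)"
    using assms(2) by (simp add: nth_append seq_list_nth of_nat_diff)
  then show ?thesis using antiperiodic_minus[OF assms(1), of "int i"] by simp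
qed (simp add: nth_append seq_list_nth)

lemma base_sum_seq_list:
  assumes f: "antiperiodic f" and p: "p \<in> {16, 1, 2, 13}"
  shows "base_sum p (seq_list f) = seq_list (base_conv p f)"
proof -
  define g where "g = (\<lambda>z. \<Sum>x\<in>I16. f (x + z))"
  \<comment> \<open>Moving the window by one drops \<open>f z\<close> and takes up
    \<open>f (z + 16)\<close>, which is \<open>- f z\<close>.\<close>
  have g: "g (z + 1) = g z - 2 * f z" for z
    using antiperiodicD[OF f, of z] unfolding g_def sum_I16 by (simp add: add_ac)
  have "sum_list (seq_list f) = g 0"
    unfolding g_def sum_I16 seq_list_def by (simp add: upto_rec1 add_ac)
  then have w: "window (sum_list (seq_list f)) (seq_list f) = seq_list g"
    using window_seq[of g f 0 16, OF g] by (simp add: seq_list_def)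
  show ?thesis
  proof (cases "p = 16")
    case True
    then have "g = base_conv p f" using base_conv_eq[OF p, of f] by (auto simp: g_def)
    then show ?thesis using True by (simp add: base_sum_def w)
  next
    case False
    have "base_sum p (seq_list f) = map2 (\<lambda>x y. x - (y + y)) (seq_list g) (drop (nat p) (seq_list f @ map uminus (seq_list f)))"
      using False by (simp add: base_sum_def w Let_def del: drop_append)
    also have "\<dots> = seq_list (base_conv p f)"
    proof (rule nth_equalityI)
      show "length (map2 (\<lambda>x y. x - (y + y)) (seq_list g) (drop (nat p) (seq_list f @ map uminus (seq_list f))))
        = length (seq_list (base_conv p f))" using p by auto
      fix i assume "i < length (map2 (\<lambda>x y. x - (y + y)) (seq_list g) (drop (nat p) (seq_list f @ map uminus (seq_list f))))"
      then have i: "i < 16" by simp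
      have "nat p + i < 32" using i p by auto
      with i show "map2 (\<lambda>x y. x - (y + y)) (seq_list g) (drop (nat p) (seq_list f @ map uminus (seq_list f))) ! i
        = seq_list (base_conv p f) ! i"
        using p False seq_list_append_nth[OF f, of "nat p + i"]
        by (auto simp: seq_list_nth base_conv_eq g_def simp del: drop_append)
    qed
    finally show ?thesis .
  qed
qed

lemma antiperiodic_base_conv: "antiperiodic f \<Longrightarrow> antiperiodic (base_conv p f)"
  by (simp add: antiperiodic_def base_conv_def sum_negf flip: add.assoc)

definition base_pair_ok :: "int list \<Rightarrow> int \<Rightarrow> bool" where
  "base_pair_ok g q \<longleftrightarrow> sum_list (map abs (base_sum q g)) \<le> 2000797767168"

text \<open>
  Splitting the check into constants keeps the simplifier from evaluating it symbolically under binders.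
\<close>

definition base_pairs_ok :: "int list \<Rightarrow> bool" where
  "base_pairs_ok f \<longleftrightarrow> list_all (base_pair_ok (base_sum 16 f)) [16, 1, 2, 13]
     \<and> list_all (base_pair_ok (base_sum 1 f)) [1, 2, 13]
     \<and> list_all (base_pair_ok (base_sum 2 f)) [2, 13]
     \<and> base_pair_ok (base_sum 13 f) 13"

definition dual_dilate_ok :: "int \<Rightarrow> bool" where
  "dual_dilate_ok u \<longleftrightarrow> base_pairs_ok (map (\<lambda>x. dual (u * x)) [0..15])"

lemma dual_list_dilate: "list_all dual_dilate_ok [1, 3, 5, 7, 9, 11, 13, 15]"
  by code_simp

text \<open>The absolute values are the third party's best reply. This settles pairs of base
  sequences with a common dilation \<open>u\<close>, whose autocorrelations overlap too much for the
  Cauchy-Schwarz estimate.\<close>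

lemma abs_sum_base_conv:
  assumes "u \<in> units" "p \<in> {16, 1, 2, 13}" "q \<in> {16, 1, 2, 13}"
  shows "(\<Sum>z\<in>I16. \<bar>base_conv q (base_conv p (\<lambda>x. dual (u * x))) z\<bar>) \<le> 2000797767168"
proof -
  let ?f = "\<lambda>x. dual (u * x)"
  have f: "antiperiodic ?f"
    using assms(1) by (intro antiperiodic_dilate[OF antiperiodic_dual]) (auto simp: units_def)
  \<comment> \<open>Symmetry in \<open>p\<close> and \<open>q\<close>, because
    \<open>base_pairs_ok\<close> checks each unordered pair only once.\<close>
  have swap: "base_conv q (base_conv p ?f) = base_conv p (base_conv q ?f)" for p q
    unfolding fun_eq_iff base_conv_def sum_distrib_left
    by (subst sum.swap) (simp add: mult_ac add_ac)
  have sl: "(\<Sum>z\<in>I16. \<bar>h z\<bar>) = sum_list (map abs (seq_list h))" for h :: "int \<Rightarrow> int"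
    unfolding sum_I16 seq_list_def by (simp add: upto_rec1 add_ac)
  have "base_pairs_ok (seq_list ?f)"
    using dual_list_dilate assms(1) by (auto simp: units_def seq_list_def dual_dilate_ok_def)
  then have "sum_list (map abs (seq_list (base_conv q (base_conv p ?f)))) \<le> 2000797767168
      \<or> sum_list (map abs (seq_list (base_conv p (base_conv q ?f)))) \<le> 2000797767168"
    using assms(2,3)
    by (auto simp: base_pairs_ok_def base_pair_ok_def base_sum_seq_list f antiperiodic_base_conv)
  then show ?thesis unfolding sl swap[of p q] by simp
qed

section \<open>Overlap of autocorrelations under a relative dilation\<close>

definition cross :: "(int \<Rightarrow> int) \<Rightarrow> (int \<Rightarrow> int) \<Rightarrow> int" where
  "cross a b = (\<Sum>d\<in>I16. autocorr a d * autocorr b d)"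

text \<open>The exceptions at 2 and 13 are mirror images of each other in the window 0 to 15, hence
  share one autocorrelation.\<close>

definition autocorr_list :: "int \<Rightarrow> int list" where
  "autocorr_list p = (if p = 16 then [16, 14, 12, 10, 8, 6, 4, 2, 0, -2, -4, -6, -8, -10, -12, -14]
     else if p = 1 then [16, 10, 12, 10, 8, 6, 4, 2, 0, -2, -4, -6, -8, -10, -12, -10]
     else [16, 10, 8, 10, 8, 6, 4, 2, 0, -2, -4, -6, -8, -10, -8, -10])"

lemma autocorr_base_seq:
  assumes "p \<in> {16, 1, 2, 13}"
  shows "seq_list (autocorr (base_seq p)) = autocorr_list p"
proof -
  have "autocorr (base_seq p) = base_conv p (base_seq p)"
    by (simp add: fun_eq_iff autocorr_def base_conv_def)
  then have "seq_list (autocorr (base_seq p)) = base_sum p (seq_list (base_seq p))"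
    using assms by (simp only: base_sum_seq_list[OF antiperiodic_base_seq])
  moreover have "base_sum 16 (seq_list (base_seq 16)) = autocorr_list 16" by code_simp
  moreover have "base_sum 1 (seq_list (base_seq 1)) = autocorr_list 1" by code_simp
  moreover have "base_sum 2 (seq_list (base_seq 2)) = autocorr_list 2" by code_simp
  moreover have "base_sum 13 (seq_list (base_seq 13)) = autocorr_list 13" by code_simp
  ultimately show ?thesis using assms by auto
qed

definition cross_ok :: "int list \<Rightarrow> int \<Rightarrow> bool" where
  "cross_ok r p \<longleftrightarrow> sum_list (map2 (*) (autocorr_list p) r) \<le> 928"

definition cross_dilate_ok :: "int list \<Rightarrow> int \<Rightarrow> bool" where
  "cross_dilate_ok e w \<longleftrightarrow> list_all (cross_ok (map (\<lambda>d. e ! nat (w * d mod 32)) [0..15])) [16, 1, 2]"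

definition cross_base_ok :: "int \<Rightarrow> bool" where
  "cross_base_ok q \<longleftrightarrow>
     list_all (cross_dilate_ok (autocorr_list q @ map uminus (autocorr_list q))) [3, 5, 7, 9, 11, 13, 15]"

lemma cross_base_list: "list_all cross_base_ok [16, 1, 2]"
  by code_simp

text \<open>Each of these sequences has energy above 928, but a nontrivial relative dilation
  \<open>w\<close> makes the two autocorrelations peak at different lags, and their inner product
  falls below the level at which Cauchy-Schwarz suffices.\<close>

lemma cross_base_seq_le:
  assumes "p \<in> {16, 1, 2, 13}" "q \<in> {16, 1, 2, 13}" "w \<in> units" "w \<noteq> 1"
  shows "(\<Sum>d\<in>I16. autocorr (base_seq p) d * autocorr (base_seq q) (w * d)) \<le> 928"
proof -
  let ?r = "\<lambda>d. autocorr (base_seq q) (w * d)"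
  have ap: "antiperiodic (autocorr (base_seq q))"
    by (intro antiperiodic_autocorr antiperiodic_base_seq)
  let ?e = "autocorr_list q @ map uminus (autocorr_list q)"
  have "cross_dilate_ok ?e w"
    using cross_base_list assms by (auto simp: cross_base_ok_def units_def autocorr_list_def)
  moreover have "map (\<lambda>d. ?e ! nat (w * d mod 32)) [0..15] = seq_list ?r"
    unfolding seq_list_def
  proof (rule map_cong[OF refl])
    fix d
    have "?e ! nat (w * d mod 32) = autocorr (base_seq q) (w * d mod 32)"
      using seq_list_append_nth[OF ap, of "nat (w * d mod 32)"] autocorr_base_seq[OF assms(2)]
      by (simp add: nat_less_iff)
    then show "?e ! nat (w * d mod 32) = ?r d" by (simp add: antiperiodic_mod[OF ap])
  qed
  ultimately have "cross_ok (seq_list ?r) p"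
    using assms(1) by (auto simp: cross_dilate_ok_def cross_ok_def autocorr_list_def)
  then have "sum_list (map2 (*) (seq_list (autocorr (base_seq p))) (seq_list ?r)) \<le> 928"
    by (simp add: cross_ok_def autocorr_base_seq[OF assms(1)])
  then show ?thesis
    unfolding sum_I16 seq_list_def by (simp add: upto_rec1 add_ac)
qed

section \<open>Fourier analysis of antiperiodic sequences\<close>

definition cos_seq :: "int \<Rightarrow> real" where "cos_seq n = cos (pi * of_int n / 16)"

lemma antiperiodic_cos_seq: "antiperiodic cos_seq"
proof -
  have "cos (pi * (of_int x + 16) / 16) = - cos (pi * of_int x / 16)" for x
  proof -
    have "pi * (of_int x + 16) / 16 = pi * of_int x / 16 + pi" by (simp add: field_simps)
    then show ?thesis by (simp only: cos_periodic_pi)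
  qed
  then show ?thesis by (simp add: antiperiodic_def cos_seq_def)
qed

lemma cos_seq_minus: "cos_seq (- n) = cos_seq n"
  by (simp add: cos_seq_def)

lemma cos_seq_reduce:
  "cos_seq 0 = 1" "cos_seq 8 = 0" "cos_seq 9 = - cos_seq 7" "cos_seq 10 = - cos_seq 6" "cos_seq 11 = - cos_seq 5"
  "cos_seq 12 = - cos_seq 4" "cos_seq 13 = - cos_seq 3" "cos_seq 14 = - cos_seq 2" "cos_seq 15 = - cos_seq 1"
  "cos_seq 16 = - 1"
  "cos_seq 17 = - cos_seq 1" "cos_seq 18 = - cos_seq 2" "cos_seq 19 = - cos_seq 3" "cos_seq 20 = - cos_seq 4"
  "cos_seq 21 = - cos_seq 5" "cos_seq 22 = - cos_seq 6" "cos_seq 23 = - cos_seq 7" "cos_seq 24 = 0"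
  "cos_seq 25 = cos_seq 7" "cos_seq 26 = cos_seq 6" "cos_seq 27 = cos_seq 5" "cos_seq 28 = cos_seq 4"
  "cos_seq 29 = cos_seq 3" "cos_seq 30 = cos_seq 2" "cos_seq 31 = cos_seq 1"
proof -
  have a: "cos_seq (n + 16) = - cos_seq n" for n by (rule antiperiodicD[OF antiperiodic_cos_seq])
  show z: "cos_seq 0 = 1" by (simp add: cos_seq_def)
  show e: "cos_seq 8 = 0" using a[of "- 8"] by (simp add: cos_seq_minus)
  show "cos_seq 9 = - cos_seq 7" "cos_seq 10 = - cos_seq 6" "cos_seq 11 = - cos_seq 5"
    "cos_seq 12 = - cos_seq 4" "cos_seq 13 = - cos_seq 3" "cos_seq 14 = - cos_seq 2" "cos_seq 15 = - cos_seq 1"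
    using a[of "- 7"] a[of "- 6"] a[of "- 5"] a[of "- 4"] a[of "- 3"] a[of "- 2"] a[of "- 1"]
    by (simp_all add: cos_seq_minus)
  note r = this
  show "cos_seq 16 = - 1"
  "cos_seq 17 = - cos_seq 1" "cos_seq 18 = - cos_seq 2" "cos_seq 19 = - cos_seq 3" "cos_seq 20 = - cos_seq 4"
  "cos_seq 21 = - cos_seq 5" "cos_seq 22 = - cos_seq 6" "cos_seq 23 = - cos_seq 7" "cos_seq 24 = 0"
  "cos_seq 25 = cos_seq 7" "cos_seq 26 = cos_seq 6" "cos_seq 27 = cos_seq 5" "cos_seq 28 = cos_seq 4"
  "cos_seq 29 = cos_seq 3" "cos_seq 30 = cos_seq 2" "cos_seq 31 = cos_seq 1"
    using a[of 0] a[of 1] a[of 2] a[of 3] a[of 4] a[of 5] a[of 6] a[of 7] a[of 8] a[of 9] a[of 10] a[of 11]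
      a[of 12] a[of 13] a[of 14] a[of 15] z e r
    by simp_all
qed

lemma cos_seq_mod: "(32::int) \<le> numeral n \<Longrightarrow> cos_seq (numeral n) = cos_seq (numeral n mod 32)"
  by (rule antiperiodic_cong[OF antiperiodic_cos_seq]) (rule mod_mod_trivial[symmetric])

lemma cos_seq_square: "(cos_seq n)\<^sup>2 = (1 + cos_seq (2 * n)) / 2"
proof -
  have eq: "pi * of_int (2 * n) / 16 = 2 * (pi * of_int n / 16)" by simp
  show ?thesis unfolding cos_seq_def eq cos_double_cos by simp
qed

lemma cos_seq_pos:
  assumes "n \<in> {0..<8}"
  shows "cos_seq n > 0"
proof -
  have "of_int n < (8::real)" "0 \<le> real_of_int n" using assms by auto
  then show ?thesis unfolding cos_seq_def by (intro cos_gt_zero_pi) (auto simp: field_simps intro: less_le_trans[OF _ mult_nonneg_nonneg])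
qed

lemma square_bounds:
  fixes c :: real
  assumes "c > 0" "l\<^sup>2 \<le> c\<^sup>2" "c\<^sup>2 \<le> u\<^sup>2" "0 \<le> u"
  shows "l \<le> c \<and> c \<le> u"
  using assms power2_le_imp_le[of l c] power2_le_imp_le[of c u] by simp

text \<open>Half-angle formulas, starting from \<open>cos_seq 4\<close>; comparing squares avoids
  roots. Every later numerical inequality is linear in these seven values.\<close>

lemma cos_seq_intervals:
  "0.70710678 \<le> cos_seq 4 \<and> cos_seq 4 \<le> 0.70710679"
  "0.92387953 \<le> cos_seq 2 \<and> cos_seq 2 \<le> 0.92387954"
  "0.38268341 \<le> cos_seq 6 \<and> cos_seq 6 \<le> 0.38268345"
  "0.98078527 \<le> cos_seq 1 \<and> cos_seq 1 \<le> 0.98078529"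
  "0.19509030 \<le> cos_seq 7 \<and> cos_seq 7 \<le> 0.19509034"
  "0.83146960 \<le> cos_seq 3 \<and> cos_seq 3 \<le> 0.83146963"
  "0.55557021 \<le> cos_seq 5 \<and> cos_seq 5 \<le> 0.55557025"
proof -
  have p: "cos_seq n > 0" if "n \<in> {1,2,3,4,5,6,7}" for n using that by (intro cos_seq_pos) auto
  have sq: "(cos_seq 1)\<^sup>2 = (1 + cos_seq 2) / 2" "(cos_seq 2)\<^sup>2 = (1 + cos_seq 4) / 2"
    "(cos_seq 3)\<^sup>2 = (1 + cos_seq 6) / 2" "(cos_seq 4)\<^sup>2 = 1 / 2"
    "(cos_seq 5)\<^sup>2 = (1 - cos_seq 6) / 2" "(cos_seq 6)\<^sup>2 = (1 - cos_seq 4) / 2"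
    "(cos_seq 7)\<^sup>2 = (1 - cos_seq 2) / 2"
    by (simp_all add: cos_seq_square cos_seq_reduce)
  show c4: "0.70710678 \<le> cos_seq 4 \<and> cos_seq 4 \<le> 0.70710679"
    by (rule square_bounds) (use p sq in \<open>auto simp: power2_eq_square\<close>)
  show c2: "0.92387953 \<le> cos_seq 2 \<and> cos_seq 2 \<le> 0.92387954"
    by (rule square_bounds) (use p c4 in \<open>simp_all add: sq\<close>, simp_all add: power2_eq_square)
  show c6: "0.38268341 \<le> cos_seq 6 \<and> cos_seq 6 \<le> 0.38268345"
    by (rule square_bounds) (use p c4 in \<open>simp_all add: sq\<close>, simp_all add: power2_eq_square)
  show "0.98078527 \<le> cos_seq 1 \<and> cos_seq 1 \<le> 0.98078529"
    by (rule square_bounds) (use p c2 in \<open>simp_all add: sq\<close>, simp_all add: power2_eq_square)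
  show "0.19509030 \<le> cos_seq 7 \<and> cos_seq 7 \<le> 0.19509034"
    by (rule square_bounds) (use p c2 in \<open>simp_all add: sq\<close>, simp_all add: power2_eq_square)
  show "0.83146960 \<le> cos_seq 3 \<and> cos_seq 3 \<le> 0.83146963"
    by (rule square_bounds) (use p c6 in \<open>simp_all add: sq\<close>, simp_all add: power2_eq_square)
  show "0.55557021 \<le> cos_seq 5 \<and> cos_seq 5 \<le> 0.55557025"
    by (rule square_bounds) (use p c6 in \<open>simp_all add: sq\<close>, simp_all add: power2_eq_square)
qed

lemmas cos_seq_bounds = cos_seq_intervals[THEN conjunct1, simplified] cos_seq_intervals[THEN conjunct2, simplified]

definition phase :: "int \<Rightarrow> int \<Rightarrow> complex" where
  "phase k x = cis (pi * of_int (k * x) / 16)"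

text \<open>Only odd frequencies are used, since an antiperiodic sequence carries no others; hence
  the arguments \<open>2 * j + 1\<close> below.\<close>

definition fourier :: "(int \<Rightarrow> real) \<Rightarrow> int \<Rightarrow> complex" where
  "fourier f k = (\<Sum>x\<in>I16. of_real (f x) * phase k x)"

lemma phase_add: "phase k (x + y) = phase k x * phase k y"
  by (simp add: phase_def cis_mult algebra_simps add_divide_distrib)

lemma cnj_phase: "cnj (phase k x) = phase k (- x)"
  by (simp add: phase_def cis_cnj)

lemma phase_16: "odd k \<Longrightarrow> phase k 16 = - 1"
proof (elim oddE)
  fix b assume "k = 2 * b + 1"
  then have "pi * of_int (k * 16) / 16 = pi + 2 * pi * of_int b" by (simp add: field_simps)
  then have "phase k 16 = cis pi * cis (2 * pi * of_int b)" by (simp only: phase_def cis_mult)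
  also have "cis (2 * pi * of_int b) = 1" by (simp add: complex_eq_iff cos_int_2pin sin_int_2pin)
  finally show ?thesis by simp
qed

text \<open>Raising \<open>j\<close> by one multiplies every summand by \<open>w\<close> but only
  permutes the sum, so the sum vanishes unless \<open>w = 1\<close>, which happens for multiples of
  16 only.\<close>

lemma phase_orthogonal:
  assumes "\<bar>d\<bar> < 16"
  shows "(\<Sum>j\<in>I16. phase (2 * j + 1) d) = (if d = 0 then 16 else 0)"
proof (cases "d = 0")
  case True then show ?thesis by (simp add: phase_def)
next
  case False
  define w where "w = cis (pi * of_int d / 8)"
  have shift: "phase (2 * (j + 1) + 1) d = w * phase (2 * j + 1) d" for j
    by (simp add: phase_def w_def cis_mult algebra_simps add_divide_distrib)
  have per: "phase (2 * (j + 16) + 1) d = phase (2 * j + 1) d" for j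
  proof -
    have "phase (2 * (j + 16) + 1) d = phase (2 * j + 1) d * cis (2 * pi * of_int d)"
      by (simp add: phase_def cis_mult algebra_simps add_divide_distrib)
    moreover have "cis (2 * pi * of_int d) = 1"
      by (simp add: complex_eq_iff cos_int_2pin sin_int_2pin)
    ultimately show ?thesis by simp
  qed
  have "(\<Sum>j\<in>I16. phase (2 * j + 1) d) = (\<Sum>j\<in>I16. phase (2 * (j + 1) + 1) d)"
    using sum_periodic_shift[of "\<lambda>j. phase (2 * j + 1) d" 1] per by simp
  also have "\<dots> = w * (\<Sum>j\<in>I16. phase (2 * j + 1) d)"
    by (simp only: shift sum_distrib_left)
  finally have "(1 - w) * (\<Sum>j\<in>I16. phase (2 * j + 1) d) = 0"
    by (simp add: algebra_simps)
  moreover have "w \<noteq> 1"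
  proof
    assume "w = 1"
    then have "cos (pi * of_int d / 8) = 1" by (simp add: w_def complex_eq_iff)
    then obtain n :: int where "pi * of_int d / 8 = of_int n * 2 * pi"
      by (auto simp: cos_one_2pi_int)
    then have "pi * of_int d = pi * of_int (16 * n)" by (simp add: field_simps)
    then have "real_of_int d = of_int (16 * n)" by (simp only: mult_cancel_left) simp
    then have "d = 16 * n" by (simp only: of_int_eq_iff)
    with assms False show False by auto
  qed
  ultimately show ?thesis using False by simp
qed

lemma parseval: "(\<Sum>j\<in>I16. (cmod (fourier f (2 * j + 1)))\<^sup>2) = 16 * (\<Sum>x\<in>I16. (f x)\<^sup>2)"
proof -
  have "complex_of_real (\<Sum>j\<in>I16. (cmod (fourier f (2 * j + 1)))\<^sup>2)
    = (\<Sum>j\<in>I16. fourier f (2 * j + 1) * cnj (fourier f (2 * j + 1)))"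
    by (simp only: of_real_sum complex_norm_square)
  also have "\<dots> = (\<Sum>j\<in>I16. \<Sum>x\<in>I16. \<Sum>y\<in>I16. of_real (f x * f y) * phase (2 * j + 1) (x - y))"
  proof (rule sum.cong[OF refl])
    fix j
    have eq: "of_real (f x) * phase (2 * j + 1) x * cnj (of_real (f y) * phase (2 * j + 1) y)
      = of_real (f x * f y) * phase (2 * j + 1) (x - y)" for x y
      using phase_add[of "2 * j + 1" x "- y"] by (simp add: cnj_phase mult_ac)
    show "fourier f (2 * j + 1) * cnj (fourier f (2 * j + 1))
      = (\<Sum>x\<in>I16. \<Sum>y\<in>I16. of_real (f x * f y) * phase (2 * j + 1) (x - y))"
      unfolding fourier_def cnj_sum sum_product eq ..
  qed
  also have "\<dots> = (\<Sum>x\<in>I16. \<Sum>y\<in>I16. \<Sum>j\<in>I16. of_real (f x * f y) * phase (2 * j + 1) (x - y))"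
    by (subst sum.swap) (rule sum.cong[OF refl], rule sum.swap)
  also have "\<dots> = (\<Sum>x\<in>I16. \<Sum>y\<in>I16. of_real (f x * f y) * (if x = y then 16 else 0))"
  proof (intro sum.cong refl)
    fix x y :: int assume "x \<in> I16" "y \<in> I16"
    then have "\<bar>x - y\<bar> < 16" by auto
    from phase_orthogonal[OF this]
    show "(\<Sum>j\<in>I16. of_real (f x * f y) * phase (2 * j + 1) (x - y)) = of_real (f x * f y) * (if x = y then 16 else 0)"
      by (simp flip: sum_distrib_left)
  qed
  also have "\<dots> = of_real (16 * (\<Sum>x\<in>I16. (f x)\<^sup>2))"
    by (simp add: if_distrib[of "\<lambda>c. _ * c"] sum_distrib_left power2_eq_square mult_ac cong: if_cong)
  finally show ?thesis by (simp only: of_real_eq_iff)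
qed

text \<open>For odd \<open>k\<close> both \<open>F\<close> and the phase change sign after a half
  period, so the product can be shifted freely within the sum over \<open>z\<close>.\<close>

lemma fourier_correlation:
  assumes F: "antiperiodic F" and k: "odd k"
  shows "fourier (\<lambda>z. \<Sum>s\<in>I16. F (s + z) * P s) k = fourier F k * cnj (fourier P k)"
proof -
  have per: "of_real (F (z + 16)) * phase k (z + 16) = of_real (F z) * phase k z" for z
    by (simp add: antiperiodicD[OF F] phase_add phase_16[OF k])
  have inner: "(\<Sum>z\<in>I16. of_real (F (s + z)) * phase k z) = phase k (- s) * fourier F k" for s
  proof -
    have "(\<Sum>z\<in>I16. of_real (F (s + z)) * phase k z)
      = (\<Sum>z\<in>I16. phase k (- s) * (of_real (F (z + s)) * phase k (z + s)))"
    proof (rule sum.cong[OF refl])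
      fix z
      show "of_real (F (s + z)) * phase k z = phase k (- s) * (of_real (F (z + s)) * phase k (z + s))"
        using phase_add[of k "- s" "z + s"] by (simp add: mult_ac add_ac)
    qed
    also have "\<dots> = phase k (- s) * (\<Sum>z\<in>I16. of_real (F (z + s)) * phase k (z + s))"
      by (simp only: sum_distrib_left)
    also have "(\<Sum>z\<in>I16. of_real (F (z + s)) * phase k (z + s)) = fourier F k"
      unfolding fourier_def by (rule sum_periodic_shift[of "\<lambda>z. of_real (F z) * phase k z"]) (rule per)
    finally show ?thesis .
  qed
  have "fourier (\<lambda>z. \<Sum>s\<in>I16. F (s + z) * P s) k
    = (\<Sum>s\<in>I16. of_real (P s) * (\<Sum>z\<in>I16. of_real (F (s + z)) * phase k z))"
    unfolding fourier_def of_real_sum sum_distrib_left sum_distrib_right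
    by (subst sum.swap) (simp add: mult_ac)
  also have "\<dots> = fourier F k * (\<Sum>s\<in>I16. of_real (P s) * phase k (- s))"
    unfolding inner sum_distrib_left by (simp add: mult_ac)
  also have "(\<Sum>s\<in>I16. of_real (P s) * phase k (- s)) = cnj (fourier P k)"
    by (simp add: fourier_def cnj_phase)
  finally show ?thesis .
qed

text \<open>By Parseval on both sides: correlating with \<open>F\<close> multiplies each Fourier
  coefficient by one of absolute value at most \<open>C\<close>.\<close>

lemma correlation_energy_le:
  assumes F: "antiperiodic F" and C: "\<And>j. j \<in> I16 \<Longrightarrow> cmod (fourier F (2 * j + 1)) \<le> C"
  shows "(\<Sum>z\<in>I16. (\<Sum>s\<in>I16. F (s + z) * P s)\<^sup>2) \<le> C\<^sup>2 * (\<Sum>s\<in>I16. (P s)\<^sup>2)"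
proof -
  let ?H = "\<lambda>z. \<Sum>s\<in>I16. F (s + z) * P s"
  have "16 * (\<Sum>z\<in>I16. (?H z)\<^sup>2) = (\<Sum>j\<in>I16. (cmod (fourier ?H (2 * j + 1)))\<^sup>2)"
    by (simp only: parseval)
  also have "\<dots> \<le> (\<Sum>j\<in>I16. C\<^sup>2 * (cmod (fourier P (2 * j + 1)))\<^sup>2)"
    by (intro sum_mono)
       (auto simp: fourier_correlation[OF F] norm_mult power_mult_distrib intro!: mult_right_mono power_mono C)
  also have "\<dots> = C\<^sup>2 * (16 * (\<Sum>s\<in>I16. (P s)\<^sup>2))"
    by (simp only: parseval flip: sum_distrib_left)
  finally show ?thesis by simp
qed

section \<open>The local bound of the Bell functional\<close>

lemma dual_values:
  "dual 0 = 3907808139" "dual 1 = 4915849344" "dual 2 = - 3422897640" "dual 3 = 6337527936"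
  "dual 4 = 2605205426" "dual 5 = - 2241495360" "dual 6 = - 1597352232" "dual 7 = - 4709652288"
  "dual 8 = 0" "dual 9 = 4709652288" "dual 10 = 1597352232" "dual 11 = 2241495360" "dual 12 = - 2605205426"
  "dual 13 = - 6337527936" "dual 14 = 3422897640" "dual 15 = - 4915849344"
  by code_simp+

text \<open>The coefficients satisfy \<open>dual (16 - x) = - dual x\<close>, so \<open>dual\<close>
  is even; the terms at \<open>x\<close> and \<open>16 - x\<close> combine to a cosine and the
  transform is real.\<close>

lemma fourier_dual:
  assumes "odd k"
  shows "fourier (\<lambda>x. of_int (dual x)) k
    = of_real (3907808139 + 2 * (4915849344 * cos_seq k - 3422897640 * cos_seq (k * 2) + 6337527936 * cos_seq (k * 3)
      + 2605205426 * cos_seq (k * 4) - 2241495360 * cos_seq (k * 5) - 1597352232 * cos_seq (k * 6)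
      - 4709652288 * cos_seq (k * 7)))"
proof -
  have p0: "phase k 0 = 1" by (simp add: phase_def)
  have refl: "phase k (16 - x) = phase k x - 2 * of_real (cos_seq (k * x))" for x
  proof -
    have "phase k x + phase k (- x) = 2 * of_real (cos_seq (k * x))"
      by (simp add: complex_eq_iff phase_def cos_seq_def)
    moreover have "phase k (16 - x) = - phase k (- x)"
      using phase_add[of k 16 "- x"] phase_16[OF assms] by simp
    ultimately show ?thesis by (simp add: algebra_simps)
  qed
  have "phase k 15 = phase k 1 - 2 * of_real (cos_seq k)" "phase k 14 = phase k 2 - 2 * of_real (cos_seq (k * 2))"
    "phase k 13 = phase k 3 - 2 * of_real (cos_seq (k * 3))" "phase k 12 = phase k 4 - 2 * of_real (cos_seq (k * 4))"
    "phase k 11 = phase k 5 - 2 * of_real (cos_seq (k * 5))" "phase k 10 = phase k 6 - 2 * of_real (cos_seq (k * 6))"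
    "phase k 9 = phase k 7 - 2 * of_real (cos_seq (k * 7))"
    using refl[of 1] refl[of 2] refl[of 3] refl[of 4] refl[of 5] refl[of 6] refl[of 7] by simp_all
  then show ?thesis
    unfolding fourier_def sum_I16 by (simp add: dual_values p0)
qed

text \<open>
  The actual maximum is about 2.034. Any bound below \<open>sqrt (4096 / 928)\<close>, about 2.101, makes sequences of energy at most
  928 harmless in the Cauchy-Schwarz estimate.
\<close>

lemma norm_fourier_dual:
  assumes "j \<in> I16"
  shows "cmod (fourier (\<lambda>x. of_int (dual x)) (2 * j + 1)) \<le> 2.1 * 7815616278"
proof -
  have odd: "odd (2 * j + 1)" by simp
  have "j = 0 \<or> j = 1 \<or> j = 2 \<or> j = 3 \<or> j = 4 \<or> j = 5 \<or> j = 6 \<or> j = 7 \<or> j = 8 \<or> j = 9 \<or> j = 10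
      \<or> j = 11 \<or> j = 12 \<or> j = 13 \<or> j = 14 \<or> j = 15"
    using assms unfolding I16_eq insert_iff empty_iff by simp
  then show ?thesis
    unfolding fourier_dual[OF odd] norm_of_real
    by (elim disjE; hypsubst; intro abs_leI; simp add: cos_seq_mod cos_seq_reduce; use cos_seq_bounds in linarith)
qed

lemma antiperiodic_add:
  assumes "antiperiodic f"
  shows "f (x + 16) = - f x" "f (x + 16 + y) = - f (x + y)" "f (x + 16 + y + z) = - f (x + y + z)"
    "f (y + (x + 16)) = - f (y + x)" "f (y + (x + 16) + z) = - f (y + x + z)"
  using antiperiodicD[OF assms, of x] antiperiodicD[OF assms, of "x + y"] antiperiodicD[OF assms, of "x + y + z"]
  by (simp_all add: add_ac)

section \<open>The Bell functional as a trilinear form\<close>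

definition trilinear :: "(int \<Rightarrow> 'a::comm_ring_1) \<Rightarrow> (int \<Rightarrow> 'a) \<Rightarrow> (int \<Rightarrow> 'a) \<Rightarrow> (int \<Rightarrow> 'a) \<Rightarrow> 'a" where
  "trilinear F a b c = (\<Sum>x\<in>I16. \<Sum>y\<in>I16. \<Sum>z\<in>I16. F (x + y + z) * a x * b y * c z)"

definition response :: "(int \<Rightarrow> 'a::comm_ring_1) \<Rightarrow> (int \<Rightarrow> 'a) \<Rightarrow> (int \<Rightarrow> 'a) \<Rightarrow> int \<Rightarrow> 'a" where
  "response F a b z = (\<Sum>x\<in>I16. \<Sum>y\<in>I16. F (x + y + z) * a x * b y)"

lemma trilinear_response: "trilinear F a b c = (\<Sum>z\<in>I16. response F a b z * c z)"
proof -
  have "trilinear F a b c = (\<Sum>x\<in>I16. \<Sum>z\<in>I16. \<Sum>y\<in>I16. F (x + y + z) * a x * b y * c z)"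
    unfolding trilinear_def by (intro sum.cong[OF refl] sum.swap)
  also have "\<dots> = (\<Sum>z\<in>I16. \<Sum>x\<in>I16. \<Sum>y\<in>I16. F (x + y + z) * a x * b y * c z)"
    by (rule sum.swap)
  finally show ?thesis by (simp add: response_def sum_distrib_right)
qed

lemma trilinear_swap12: "trilinear F a b c = trilinear F b a c"
  unfolding trilinear_def by (subst sum.swap) (simp add: add_ac mult_ac)

lemma trilinear_swap23: "trilinear F a b c = trilinear F a c b"
  unfolding trilinear_def
  by (rule sum.cong[OF refl], subst sum.swap) (simp add: add_ac mult_ac)

definition convolution :: "(int \<Rightarrow> 'a::comm_ring_1) \<Rightarrow> (int \<Rightarrow> 'a) \<Rightarrow> int \<Rightarrow> 'a" where
  "convolution a b s = (\<Sum>x\<in>I16. a x * b (s - x))"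

lemma response_convolution:
  assumes F: "antiperiodic F" and b: "antiperiodic b"
  shows "response F a b z = (\<Sum>s\<in>I16. F (s + z) * convolution a b s)"
proof -
  have "(\<Sum>y\<in>I16. F (x + y + z) * a x * b y) = (\<Sum>s\<in>I16. F (s + z) * (a x * b (s - x)))" for x
  proof -
    have "(\<Sum>y\<in>I16. F (y + x + z) * (a x * b (y + x - x))) = (\<Sum>s\<in>I16. F (s + z) * (a x * b (s - x)))"
      by (rule sum_periodic_shift[of "\<lambda>s. F (s + z) * (a x * b (s - x))" x])
        (use antiperiodic_mult_shift[OF F b, of _ z "- x"] in \<open>simp add: mult.left_commute\<close>)
    then show ?thesis by (simp add: add_ac mult_ac)
  qed
  then show ?thesis
    unfolding response_def convolution_def sum_distrib_left by (subst sum.swap) simp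
qed

text \<open>On the Fourier side both are the sum of the products of the two power spectra, up to the
  same factor. Here the substitution \<open>x' = x + d\<close> replaces that detour.\<close>

lemma convolution_energy:
  assumes a: "antiperiodic a" and b: "antiperiodic b"
  shows "(\<Sum>s\<in>I16. (convolution a b s)\<^sup>2) = cross a b"
proof -
  have inner: "(\<Sum>x'\<in>I16. (a x * b (s - x)) * (a x' * b (s - x')))
    = (\<Sum>d\<in>I16. (a x * a (x + d)) * (b (s - x) * b (s - x - d)))" for x s
  proof -
    have "(\<Sum>d\<in>I16. (a x * b (s - x)) * (a (d + x) * b (s - (d + x))))
      = (\<Sum>x'\<in>I16. (a x * b (s - x)) * (a x' * b (s - x')))"
    proof (rule sum_periodic_shift)
      fix y
      show "a x * b (s - x) * (a (y + 16) * b (s - (y + 16))) = a x * b (s - x) * (a y * b (s - y))"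
        using antiperiodicD[OF a, of y] antiperiodic_minus[OF b, of "s - y"] by (simp add: algebra_simps)
    qed
    then show ?thesis by (simp add: algebra_simps)
  qed
  have "(\<Sum>s\<in>I16. b (s - x) * b (s - x - d)) = autocorr b d" for x d
  proof -
    have "(\<Sum>s\<in>I16. b (s + - x) * b (s + - x - d)) = (\<Sum>s\<in>I16. b s * b (s - d))"
      by (rule sum_periodic_shift[of "\<lambda>s. b s * b (s - d)" "- x"])
        (use antiperiodic_mult_shift[OF b b, of _ 0 "- d"] in simp)
    then show ?thesis using autocorr_minus[OF b, of d] by (simp add: autocorr_def)
  qed
  then have shift: "(\<Sum>s\<in>I16. (a x * a (x + d)) * (b (s - x) * b (s - x - d))) = (a x * a (x + d)) * autocorr b d" for x d
    by (simp flip: sum_distrib_left)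
  have "(\<Sum>s\<in>I16. (convolution a b s)\<^sup>2)
    = (\<Sum>s\<in>I16. \<Sum>x\<in>I16. \<Sum>d\<in>I16. (a x * a (x + d)) * (b (s - x) * b (s - x - d)))"
    unfolding convolution_def power2_eq_square sum_product inner ..
  also have "\<dots> = (\<Sum>d\<in>I16. \<Sum>x\<in>I16. \<Sum>s\<in>I16. (a x * a (x + d)) * (b (s - x) * b (s - x - d)))"
    by (subst sum.swap, subst (2) sum.swap, subst sum.swap) rule
  also have "\<dots> = cross a b"
    unfolding shift cross_def autocorr_def[of a] by (simp add: sum_distrib_right)
  finally show ?thesis .
qed

lemma antiperiodic_response:
  assumes "antiperiodic F" shows "antiperiodic (response F a b)"
  using assms by (simp add: antiperiodic_def response_def sum_negf flip: add.assoc)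

text \<open>Cauchy-Schwarz over the 16 values of \<open>z\<close>, then the spectral bound. In units
  of 7815616278 the estimate closes because 16 * 2.1 * 2.1 * 928 is below 256 squared.\<close>

lemma response_bound_cross:
  assumes a: "antiperiodic a" and b: "antiperiodic b" and cr: "cross a b \<le> 928"
  shows "(\<Sum>z\<in>I16. \<bar>response dual a b z\<bar>) \<le> 2000797767168"
proof -
  let ?H = "\<lambda>z. real_of_int (response dual a b z)"
  let ?F = "\<lambda>x. real_of_int (dual x)"
  have F: "antiperiodic ?F" using antiperiodic_dual by (simp add: antiperiodic_def)
  have "(\<Sum>z\<in>I16. \<bar>?H z\<bar>)\<^sup>2 \<le> (\<Sum>z\<in>I16. (\<bar>?H z\<bar>)\<^sup>2) * real (card I16)"
    by (rule sum_squared_le_sum_of_squares)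
  also have "\<dots> = 16 * (\<Sum>z\<in>I16. (?H z)\<^sup>2)" by simp
  also have "\<dots> = 16 * (\<Sum>z\<in>I16. (\<Sum>s\<in>I16. ?F (s + z) * of_int (convolution a b s))\<^sup>2)"
    by (simp add: response_convolution[OF antiperiodic_dual b])
  also have "\<dots> \<le> 16 * ((2.1 * 7815616278)\<^sup>2 * (\<Sum>s\<in>I16. (of_int (convolution a b s))\<^sup>2))"
    by (intro mult_left_mono correlation_energy_le F norm_fourier_dual) auto
  also have "(\<Sum>s\<in>I16. (of_int (convolution a b s))\<^sup>2) = real_of_int (cross a b)"
    unfolding convolution_energy[OF a b, symmetric] by simp
  also have "16 * ((2.1 * 7815616278)\<^sup>2 * real_of_int (cross a b)) \<le> 16 * ((2.1 * 7815616278)\<^sup>2 * 928)"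
    using cr by simp
  also have "\<dots> \<le> (2000797767168::real)\<^sup>2" by (simp add: power2_eq_square)
  finally have "(\<Sum>z\<in>I16. \<bar>?H z\<bar>) \<le> 2000797767168"
    by (rule power2_le_imp_le) simp
  then have "real_of_int (\<Sum>z\<in>I16. \<bar>response dual a b z\<bar>) \<le> of_int 2000797767168" by simp
  then show ?thesis by (simp only: of_int_le_iff)
qed

lemma response_bound_small:
  assumes a: "antiperiodic a" and b: "antiperiodic b" and en: "energy a \<le> 928" "energy b \<le> 928"
  shows "(\<Sum>z\<in>I16. \<bar>response dual a b z\<bar>) \<le> 2000797767168"
proof -
  have "2 * cross a b \<le> energy a + energy b"
  proof -
    have "2 * (autocorr a d * autocorr b d) \<le> (autocorr a d)\<^sup>2 + (autocorr b d)\<^sup>2" for d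
      using zero_le_power2[of "autocorr a d - autocorr b d"] by (simp add: power2_diff)
    then show ?thesis
      unfolding cross_def energy_def sum_distrib_left sum.distrib[symmetric] by (intro sum_mono)
  qed
  then show ?thesis using en by (intro response_bound_cross a b) linarith
qed

text \<open>A common dilation can be moved from the sequences into the functional, which leaves the
  exactly evaluated base sequences. Different dilations make the overlap small enough for the
  Fourier estimate.\<close>

lemma response_bound_large:
  assumes a: "sign_seq a" and b: "sign_seq b" and en: "energy a > 928" "energy b > 928"
  shows "(\<Sum>z\<in>I16. \<bar>response dual a b z\<bar>) \<le> 2000797767168"
proof -
  have ap: "antiperiodic a" and bp: "antiperiodic b" using a b by (auto simp: sign_seq_def)
  obtain u p t where u: "u \<in> units" and p: "p \<in> {16, 1, 2, 13}" and a_eq: "\<And>x. a (u * x) = base_seq p (x + t)"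
    using energy_classification[OF a en(1)] by metis
  obtain v q s where v: "v \<in> units" and q: "q \<in> {16, 1, 2, 13}" and b_eq: "\<And>x. b (v * x) = base_seq q (x + s)"
    using energy_classification[OF b en(2)] by metis
  have oddu: "odd u" and oddv: "odd v" using u v by (auto simp: units_def)
  show ?thesis
  proof (cases "u = v")
    case True
    define f where "f = (\<lambda>x. dual (u * x))"
    have f: "antiperiodic f" unfolding f_def by (rule antiperiodic_dilate[OF antiperiodic_dual oddu])
    have resp: "response dual a b (u * z) = base_conv q (base_conv p f) (z - t - s)" for z
    proof -
      have "response dual a b (u * z) = (\<Sum>x\<in>I16. \<Sum>y\<in>I16. dual (u * x + u * y + u * z) * a (u * x) * b (u * y))"
      proof -
        have "(\<Sum>y\<in>I16. dual (x + u * y + u * z) * a x * b (u * y))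
          = (\<Sum>y\<in>I16. dual (x + y + u * z) * a x * b y)" for x
          by (rule sum_periodic_dilate[of "\<lambda>y. dual (x + y + u * z) * a x * b y", OF _ oddu])
            (simp add: antiperiodic_add[OF bp] antiperiodic_add[OF antiperiodic_dual])
        moreover have "(\<Sum>x\<in>I16. \<Sum>y\<in>I16. dual (u * x + y + u * z) * a (u * x) * b y)
          = (\<Sum>x\<in>I16. \<Sum>y\<in>I16. dual (x + y + u * z) * a x * b y)"
          by (rule sum_periodic_dilate[of "\<lambda>x. \<Sum>y\<in>I16. dual (x + y + u * z) * a x * b y", OF _ oddu])
            (simp add: antiperiodic_add[OF ap] antiperiodic_add[OF antiperiodic_dual] sum_negf)
        ultimately show ?thesis unfolding response_def by simp
      qed
      also have "\<dots> = (\<Sum>x\<in>I16. \<Sum>y\<in>I16. f (x + y + z) * base_seq p (x + t) * base_seq q (y + s))"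
        by (simp add: f_def a_eq b_eq[folded True] flip: distrib_left)
      also have "\<dots> = (\<Sum>x\<in>I16. \<Sum>y\<in>I16. f (x + y + (z - t - s)) * base_seq p x * base_seq q y)"
      proof -
        have "(\<Sum>y\<in>I16. f (x + (y + s) + (z - s)) * base_seq p (x + t) * base_seq q (y + s))
          = (\<Sum>y\<in>I16. f (x + y + (z - s)) * base_seq p (x + t) * base_seq q y)" for x
          by (rule sum_periodic_shift[of "\<lambda>y. f (x + y + (z - s)) * base_seq p (x + t) * base_seq q y"])
            (simp add: antiperiodic_add[OF antiperiodic_base_seq] antiperiodic_add[OF f])
        moreover have "(\<Sum>x\<in>I16. \<Sum>y\<in>I16. f ((x + t) + y + (z - t - s)) * base_seq p (x + t) * base_seq q y)
          = (\<Sum>x\<in>I16. \<Sum>y\<in>I16. f (x + y + (z - t - s)) * base_seq p x * base_seq q y)"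
          by (rule sum_periodic_shift[of "\<lambda>x. \<Sum>y\<in>I16. f (x + y + (z - t - s)) * base_seq p x * base_seq q y"])
            (simp add: antiperiodic_add[OF antiperiodic_base_seq] antiperiodic_add[OF f])
        ultimately show ?thesis by (simp add: algebra_simps)
      qed
      also have "\<dots> = base_conv q (base_conv p f) (z - t - s)"
        unfolding base_conv_def sum_distrib_left
        by (subst sum.swap) (simp add: add_ac mult_ac)
      finally show ?thesis .
    qed
    have "(\<Sum>z\<in>I16. \<bar>response dual a b z\<bar>) = (\<Sum>z\<in>I16. \<bar>response dual a b (u * z)\<bar>)"
      by (rule sum_periodic_dilate[symmetric, of "\<lambda>z. \<bar>response dual a b z\<bar>", OF _ oddu])
        (simp add: antiperiodicD[OF antiperiodic_response[OF antiperiodic_dual]])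
    also have "\<dots> = (\<Sum>z\<in>I16. \<bar>base_conv q (base_conv p f) (z + (- t - s))\<bar>)"
      by (simp add: resp add_diff_eq)
    also have "\<dots> = (\<Sum>z\<in>I16. \<bar>base_conv q (base_conv p f) z\<bar>)"
      by (rule sum_periodic_shift[of "\<lambda>z. \<bar>base_conv q (base_conv p f) z\<bar>"])
        (simp add: antiperiodicD[OF antiperiodic_base_conv[OF antiperiodic_base_conv[OF f]]])
    finally show ?thesis using abs_sum_base_conv[OF u p q] by (simp add: f_def)
  next
    case False
    have au: "autocorr a (u * d) = autocorr (base_seq p) d" for d
      using autocorr_dilate[OF ap oddu, of d] autocorr_shift[OF antiperiodic_base_seq, of p t d] by (simp add: a_eq)
    have bv: "autocorr b (v * d) = autocorr (base_seq q) d" for d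
      using autocorr_dilate[OF bp oddv, of d] autocorr_shift[OF antiperiodic_base_seq, of q s d] by (simp add: b_eq)
    \<comment> \<open>\<open>w\<close> is the quotient of \<open>u\<close> and \<open>v\<close>
      modulo 32 up to sign; the sign is harmless because autocorrelations are even.\<close>
    have "\<exists>w\<in>units. w \<noteq> 1 \<and> ((v * w) mod 32 = u mod 32 \<or> (v * w) mod 32 = (- u) mod 32)"
      using u v False unfolding units_def by (elim insertE; simp)
    then obtain w where w: "w \<in> units" "w \<noteq> 1" and vw: "(v * w) mod 32 = u mod 32 \<or> (v * w) mod 32 = (- u) mod 32"
      by blast
    have bu: "autocorr b (u * d) = autocorr (base_seq q) (w * d)" for d
    proof -
      have "autocorr b (v * w * d) = autocorr b (u * d)"
        using vw
      proof
        assume "(v * w) mod 32 = u mod 32"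
        then have "(v * w * d) mod 32 = (u * d) mod 32" by (metis mod_mult_left_eq)
        then show ?thesis by (rule antiperiodic_cong[OF antiperiodic_autocorr[OF bp]])
      next
        assume "(v * w) mod 32 = (- u) mod 32"
        then have "(v * w * d) mod 32 = (- (u * d)) mod 32" by (metis mod_mult_left_eq mult_minus_left)
        then have "autocorr b (v * w * d) = autocorr b (- (u * d))"
          by (rule antiperiodic_cong[OF antiperiodic_autocorr[OF bp]])
        then show ?thesis by (simp add: autocorr_minus[OF bp])
      qed
      then show ?thesis using bv[of "w * d"] by (simp add: mult.assoc)
    qed
    have "cross a b = (\<Sum>d\<in>I16. autocorr a (u * d) * autocorr b (u * d))"
      unfolding cross_def
      by (rule sum_periodic_dilate[symmetric, OF _ oddu])
        (simp add: antiperiodicD[OF antiperiodic_autocorr[OF ap]] antiperiodicD[OF antiperiodic_autocorr[OF bp]])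
    also have "\<dots> \<le> 928" unfolding au bu by (rule cross_base_seq_le[OF p q w])
    finally show ?thesis by (rule response_bound_cross[OF ap bp])
  qed
qed

text \<open>Two of the three sequences lie on the same side of the energy 928, and the form is
  symmetric because the functional depends only on the sum of the settings. The third sequence is
  absorbed into an absolute value.\<close>

lemma trilinear_dual_le:
  assumes a: "sign_seq a" and b: "sign_seq b" and c: "sign_seq c"
  shows "trilinear dual a b c \<le> 2000797767168"
proof -
  have pair: "trilinear dual a b c \<le> 2000797767168"
    if a: "sign_seq a" and b: "sign_seq b" and c: "sign_seq c" and "energy a > 928 \<longleftrightarrow> energy b > 928" for a b c
  proof -
    have "trilinear dual a b c \<le> (\<Sum>z\<in>I16. \<bar>response dual a b z\<bar>)"
      unfolding trilinear_response
    proof (rule sum_mono)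
      fix z
      have "c z = 1 \<or> c z = - 1" using c by (simp add: sign_seq_def)
      then show "response dual a b z * c z \<le> \<bar>response dual a b z\<bar>" by auto
    qed
    also have "\<dots> \<le> 2000797767168"
    proof (cases "energy a > 928")
      case True then show ?thesis using that response_bound_large by blast
    next
      case False then show ?thesis using that by (intro response_bound_small) (auto simp: sign_seq_def)
    qed
    finally show ?thesis .
  qed
  consider "energy a > 928 \<longleftrightarrow> energy b > 928" | "energy a > 928 \<longleftrightarrow> energy c > 928" | "energy b > 928 \<longleftrightarrow> energy c > 928"
    by blast
  then show ?thesis
  proof cases
    case 1 then show ?thesis by (rule pair[OF a b c])
  next
    case 2 then show ?thesis using pair[OF a c b] by (simp add: trilinear_swap23[of _ a b c])
  next
    case 3 then show ?thesis using pair[OF b c a]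
      by (simp add: trilinear_swap12[of _ a b c] trilinear_swap23[of _ b a c])
  qed
qed

lemma sign_seq_attains:
  obtains s where "sign_seq s" "\<And>x. x \<in> I16 \<Longrightarrow> \<bar>g x :: real\<bar> = of_int (s x) * g x"
proof
  let ?s = "\<lambda>x. (if g (x mod 16) \<ge> 0 then 1 else - 1) * (if even (x div 16) then 1 else - 1 :: int)"
  show "sign_seq ?s" by (auto simp: sign_seq_def antiperiodic_def)
  show "\<bar>g x\<bar> = of_int (?s x) * g x" if "x \<in> I16" for x using that by auto
qed

text \<open>The form is linear in \<open>c\<close>, so replacing \<open>c\<close> by the signs of
  the response cannot lower it. Applied to each argument in turn, this rounds random responses to
  deterministic ones.\<close>

lemma trilinear_sign_seq:
  fixes a b c :: "int \<Rightarrow> real"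
  assumes "\<And>x. x \<in> I16 \<Longrightarrow> \<bar>c x\<bar> \<le> 1"
  obtains s where "sign_seq s" "trilinear F a b c \<le> trilinear F a b (\<lambda>x. of_int (s x))"
proof -
  obtain s where s: "sign_seq s" "\<And>x. x \<in> I16 \<Longrightarrow> \<bar>response F a b x\<bar> = of_int (s x) * response F a b x"
    using sign_seq_attains[of "response F a b"] by blast
  have "trilinear F a b c \<le> trilinear F a b (\<lambda>x. of_int (s x))"
    unfolding trilinear_response
  proof (rule sum_mono)
    fix z assume z: "z \<in> I16"
    have "response F a b z * c z \<le> \<bar>response F a b z\<bar> * \<bar>c z\<bar>"
      by (metis abs_ge_self abs_mult)
    also have "\<dots> \<le> \<bar>response F a b z\<bar> * 1" by (intro mult_left_mono assms z) simp
    finally show "response F a b z * c z \<le> response F a b z * of_int (s z)"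
      using s(2)[OF z] by (simp add: mult.commute)
  qed
  with s(1) that show ?thesis by blast
qed

lemma trilinear_dual_real_le:
  fixes a b c :: "int \<Rightarrow> real"
  assumes "\<And>x. x \<in> I16 \<Longrightarrow> \<bar>a x\<bar> \<le> 1" "\<And>x. x \<in> I16 \<Longrightarrow> \<bar>b x\<bar> \<le> 1" "\<And>x. x \<in> I16 \<Longrightarrow> \<bar>c x\<bar> \<le> 1"
  shows "trilinear (\<lambda>x. of_int (dual x)) a b c \<le> 2000797767168"
proof -
  let ?F = "\<lambda>x. real_of_int (dual x)"
  let ?r = "\<lambda>s x. real_of_int (s x)"
  obtain s1 where s1: "sign_seq s1" "trilinear ?F a b c \<le> trilinear ?F a b (?r s1)"
    by (rule trilinear_sign_seq[where F = ?F and a = a and b = b, OF assms(3)])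
  obtain s2 where s2: "sign_seq s2" "trilinear ?F a (?r s1) b \<le> trilinear ?F a (?r s1) (?r s2)"
    by (rule trilinear_sign_seq[where F = ?F and a = a and b = "?r s1", OF assms(2)])
  obtain s3 where s3: "sign_seq s3" "trilinear ?F (?r s1) (?r s2) a \<le> trilinear ?F (?r s1) (?r s2) (?r s3)"
    by (rule trilinear_sign_seq[where F = ?F and a = "?r s1" and b = "?r s2", OF assms(1)])
  have "trilinear ?F a (?r s1) (?r s2) = trilinear ?F (?r s1) (?r s2) a"
    using trilinear_swap12[of ?F a "?r s1" "?r s2"] trilinear_swap23[of ?F "?r s1" a "?r s2"] by simp
  moreover have "trilinear ?F a b (?r s1) = trilinear ?F a (?r s1) b" by (rule trilinear_swap23)
  moreover have "trilinear ?F (?r s1) (?r s2) (?r s3) = of_int (trilinear dual s1 s2 s3)"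
    by (simp add: trilinear_def)
  moreover have "real_of_int (trilinear dual s1 s2 s3) \<le> of_int 2000797767168"
    unfolding of_int_le_iff by (rule trilinear_dual_le[OF s1(1) s2(1) s3(1)])
  ultimately show ?thesis using s1 s2 s3 by simp
qed

section \<open>Outcome probabilities of the noisy GHZ state\<close>

lemma prod_UNIV_3: "(\<Prod>n\<in>(UNIV :: 3 set). f n) = f 1 * f 2 * (f 3 :: 'a::comm_monoid_mult)"
  unfolding UNIV_3 by (subst prod.insert; simp add: mult.assoc)

lemma outcome_effect_entries:
  "outcome_effect a x $ 1 $ 1 = of_real ((1 + a * x $ 3) / 2)"
  "outcome_effect a x $ 2 $ 2 = of_real ((1 - a * x $ 3) / 2)"
  "outcome_effect a x $ 1 $ 2 = of_real (a / 2) * (of_real (x $ 1) - \<i> * of_real (x $ 2))"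
  "outcome_effect a x $ 2 $ 1 = of_real (a / 2) * (of_real (x $ 1) + \<i> * of_real (x $ 2))"
  unfolding outcome_effect_def pauli_dot_def pauli_X_def pauli_Y_def pauli_Z_def mat_def
  by (rule complex_eqI; simp)+

lemma trace_outcome_effect: "(\<Sum>j\<in>UNIV. outcome_effect a x $ j $ j) = 1"
proof -
  have "of_real ((1 + c) / 2) + of_real ((1 - c) / 2) = (1 :: complex)" for c
    by (simp add: field_simps)
  then show ?thesis by (simp only: sum_2 outcome_effect_entries)
qed

lemma trace_tensor_op: "trace (tensor_op B) = (\<Prod>n\<in>UNIV. \<Sum>j\<in>UNIV. B n $ j $ j)"
proof -
  have "(\<Prod>n\<in>UNIV. \<Sum>j\<in>UNIV. B n $ j $ j) = (\<Sum>g\<in>Pi\<^sub>E UNIV (\<lambda>_. UNIV). \<Prod>n\<in>UNIV. B n $ g n $ g n)"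
    by (rule prod_sum_PiE) simp_all
  moreover have "Pi\<^sub>E UNIV (\<lambda>_. UNIV) = (UNIV :: (3 \<Rightarrow> 2) set)"
    by (auto simp: PiE_def extensional_def)
  ultimately show ?thesis by (simp only: trace_def tensor_op_def vec_lambda_beta)
qed

lemma sum_GHZ_ket: "(\<Sum>i\<in>UNIV. GHZ_ket $ i * g i) = (g (\<lambda>_. 1) + g (\<lambda>_. 2)) / of_real (sqrt 2)"
proof -
  have ne: "(\<lambda>_. 1) \<noteq> (\<lambda>_::3. 2::2)" by (simp add: fun_eq_iff)
  have "GHZ_ket $ i * g i = (if i = (\<lambda>_. 1) then g i / of_real (sqrt 2) else 0)
      + (if i = (\<lambda>_. 2) then g i / of_real (sqrt 2) else 0)" for i
    using ne by (auto simp: GHZ_ket_def axis_def scaleR_conv_of_real[where ?'a = complex])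
  then show ?thesis by (simp add: sum.distrib add_divide_distrib)
qed

lemma trace_ket_bra_GHZ:
  "trace (ket_bra GHZ_ket ** T) =
    (T $ (\<lambda>_. 1) $ (\<lambda>_. 1) + T $ (\<lambda>_. 1) $ (\<lambda>_. 2) + T $ (\<lambda>_. 2) $ (\<lambda>_. 1) + T $ (\<lambda>_. 2) $ (\<lambda>_. 2)) / 2"
proof -
  have real: "cnj (GHZ_ket $ k) = GHZ_ket $ k" for k
    by (simp add: GHZ_ket_def axis_def)
  have "trace (ket_bra GHZ_ket ** T) = (\<Sum>i\<in>UNIV. GHZ_ket $ i * (\<Sum>k\<in>UNIV. GHZ_ket $ k * T $ k $ i))"
    by (simp add: trace_def matrix_matrix_mult_def ket_bra_def real sum_distrib_left mult_ac)
  also have "\<dots> = (T $ (\<lambda>_. 1) $ (\<lambda>_. 1) + T $ (\<lambda>_. 1) $ (\<lambda>_. 2) + T $ (\<lambda>_. 2) $ (\<lambda>_. 1) + T $ (\<lambda>_. 2) $ (\<lambda>_. 2))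
      / (of_real (sqrt 2) * of_real (sqrt 2))"
    by (simp only: sum_GHZ_ket) (simp add: add_divide_distrib)
  also have "complex_of_real (sqrt 2) * of_real (sqrt 2) = 2"
    by (simp flip: of_real_mult)
  finally show ?thesis .
qed

text \<open>The GHZ projector lives on two basis kets, so it sees only four entries of the tensor
  product, each a product over the parties. The noise contributes a constant because every effect
  has trace 1.\<close>

lemma GHZ_prob_eq:
  "GHZ_prob v a x = of_real v * ((\<Prod>n\<in>UNIV. outcome_effect (a n) (x n) $ 1 $ 1)
      + (\<Prod>n\<in>UNIV. outcome_effect (a n) (x n) $ 1 $ 2) + (\<Prod>n\<in>UNIV. outcome_effect (a n) (x n) $ 2 $ 1)
      + (\<Prod>n\<in>UNIV. outcome_effect (a n) (x n) $ 2 $ 2)) / 2 + of_real ((1 - v) / 8)"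
proof -
  let ?T = "tensor_op (\<lambda>n. outcome_effect (a n) (x n))"
  have "GHZ_prob v a x = of_real v * trace (ket_bra GHZ_ket ** ?T) + of_real ((1 - v) / 8) * trace ?T"
  proof -
    have entry: "noisy_GHZ v $ i $ k = of_real v * ket_bra GHZ_ket $ i $ k + (if k = i then of_real ((1 - v) / 8) else 0)"
      for i k
      by (simp add: noisy_GHZ_def mat_def scaleR_conv_of_real[where ?'a = complex])
    have "noisy_GHZ v $ i $ k * ?T $ k $ i = of_real v * (ket_bra GHZ_ket $ i $ k * ?T $ k $ i)
        + (if k = i then of_real ((1 - v) / 8) * ?T $ k $ i else 0)" for i k
      unfolding entry by (cases "k = i") (simp_all only: simp_thms if_True if_False distrib_right mult.assoc add_0_right)
    then have "GHZ_prob v a x = (\<Sum>i\<in>UNIV. \<Sum>k\<in>UNIV. of_real v * (ket_bra GHZ_ket $ i $ k * ?T $ k $ i)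
        + (if k = i then of_real ((1 - v) / 8) * ?T $ k $ i else 0))"
      by (simp only: GHZ_prob_def trace_def matrix_matrix_mult_def vec_lambda_beta)
    also have "\<dots> = (\<Sum>i\<in>UNIV. of_real v * (\<Sum>k\<in>UNIV. ket_bra GHZ_ket $ i $ k * ?T $ k $ i) + of_real ((1 - v) / 8) * ?T $ i $ i)"
      by (simp only: sum.distrib sum.delta finite if_True UNIV_I sum_distrib_left)
    finally show ?thesis
      by (simp only: trace_def matrix_matrix_mult_def vec_lambda_beta sum.distrib sum_distrib_left)
  qed
  moreover have diag: "?T $ (\<lambda>_. i) $ (\<lambda>_. j) = (\<Prod>n\<in>UNIV. outcome_effect (a n) (x n) $ i $ j)" for i j
    by (simp add: tensor_op_def)
  ultimately show ?thesis
    unfolding trace_ket_bra_GHZ trace_tensor_op trace_outcome_effect diag prod.neutral_const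
    by (simp only: mult_1_right times_divide_eq_right)
qed

lemma GHZ_prob_zero: "GHZ_prob 0 a x = 1 / 8"
  by (simp add: GHZ_prob_eq)

text \<open>Equatorial effects have diagonal entries 1/2 and off-diagonal entries that are pure
  phases up to a factor. The phases multiply to the sum of the angles, and the conjugate pair adds
  up to a cosine.\<close>

lemma GHZ_prob_equatorial:
  "GHZ_prob v a (\<lambda>n. equatorial_direction m (k n))
    = of_real ((1 + v * (\<Prod>n\<in>UNIV. a n) * cos (\<Sum>n\<in>UNIV. (real (k n) - 1) * pi / real m)) / 8)"
proof -
  define t where "t = (\<lambda>n. (real (k n) - 1) * pi / real m)"
  have ent: "equatorial_direction m (k n) $ 1 = cos (t n)" "equatorial_direction m (k n) $ 2 = sin (t n)"
    "equatorial_direction m (k n) $ 3 = 0" for n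
    by (simp_all add: equatorial_direction_def t_def)
  have e12: "outcome_effect (a n) (equatorial_direction m (k n)) $ 1 $ 2 = of_real (a n / 2) * cis (- t n)" for n
    by (simp add: outcome_effect_entries ent complex_eq_iff)
  have e21: "outcome_effect (a n) (equatorial_direction m (k n)) $ 2 $ 1 = of_real (a n / 2) * cis (t n)" for n
    by (simp add: outcome_effect_entries ent complex_eq_iff)
  have "(\<Prod>n\<in>UNIV. of_real (a n / 2) * cis (- t n)) + (\<Prod>n\<in>UNIV. of_real (a n / 2) * cis (t n))
    = of_real ((\<Prod>n\<in>UNIV. a n) / 8) * (cis (- (\<Sum>n\<in>UNIV. t n)) + cis (\<Sum>n\<in>UNIV. t n))"
  proof -
    have "cis (- (t 1 + t 2 + t 3)) = cis (- t 1) * cis (- t 2) * cis (- t 3)"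
      "cis (t 1 + t 2 + t 3) = cis (t 1) * cis (t 2) * cis (t 3)"
      by (simp_all add: cis_mult algebra_simps)
    then show ?thesis unfolding prod_UNIV_3 sum_3 by (simp only:) (simp add: algebra_simps)
  qed
  also have "cis (- (\<Sum>n\<in>UNIV. t n)) + cis (\<Sum>n\<in>UNIV. t n) = of_real (2 * cos (\<Sum>n\<in>UNIV. t n))"
    by (simp add: complex_eq_iff)
  finally have off: "(\<Prod>n\<in>UNIV. of_real (a n / 2) * cis (- t n)) + (\<Prod>n\<in>UNIV. of_real (a n / 2) * cis (t n))
    = of_real ((\<Prod>n\<in>UNIV. a n) / 8 * (2 * cos (\<Sum>n\<in>UNIV. t n)))" by simp
  have diag: "(\<Prod>n\<in>UNIV. outcome_effect (a n) (equatorial_direction m (k n)) $ 1 $ 1) = of_real (1 / 8)"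
    "(\<Prod>n\<in>UNIV. outcome_effect (a n) (equatorial_direction m (k n)) $ 2 $ 2) = of_real (1 / 8)"
    unfolding prod_UNIV_3 by (simp_all add: outcome_effect_entries ent)
  have "GHZ_prob v a (\<lambda>n. equatorial_direction m (k n))
    = of_real v * (of_real (1 / 8) + of_real ((\<Prod>n\<in>UNIV. a n) / 8 * (2 * cos (\<Sum>n\<in>UNIV. t n))) + of_real (1 / 8)) / 2
      + of_real ((1 - v) / 8)"
    unfolding GHZ_prob_eq diag e12 e21 off[symmetric] by simp
  also have "\<dots> = of_real (v * (1 / 8 + (\<Prod>n\<in>UNIV. a n) / 8 * (2 * cos (\<Sum>n\<in>UNIV. t n)) + 1 / 8) / 2 + (1 - v) / 8)"
    by simp
  also have "v * (1 / 8 + (\<Prod>n\<in>UNIV. a n) / 8 * (2 * cos (\<Sum>n\<in>UNIV. t n)) + 1 / 8) / 2 + (1 - v) / 8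
    = (1 + v * (\<Prod>n\<in>UNIV. a n) * cos (\<Sum>n\<in>UNIV. t n)) / 8"
    by (simp add: field_simps)
  finally show ?thesis by (simp only: t_def)
qed

section \<open>Upper bound on the local visibility\<close>

definition inverse_threshold :: real where
  "inverse_threshold = 1 / 2 + 2 / 3 * cos_seq 4 - (120 * cos_seq 2 + 56 * cos_seq 6) / 137
     + (11960704 * cos_seq 1 - 11459008 * cos_seq 7) / 9508049
     + (15419776 * cos_seq 3 - 5453760 * cos_seq 5) / 9508049"

lemma v16_GHZ3_eq: "v16_GHZ3 = inverse inverse_threshold"
proof -
  have s: "sin (pi / 8) = cos_seq 6" "sin (pi / 16) = cos_seq 7" "sin (3 * pi / 16) = cos_seq 5"
    unfolding cos_seq_def sin_cos_eq by (rule arg_cong[of _ _ cos], simp add: field_simps)+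
  have c: "cos (pi / 8) = cos_seq 2" "cos (pi / 16) = cos_seq 1" "cos (3 * pi / 16) = cos_seq 3"
    unfolding cos_seq_def by (rule arg_cong[of _ _ cos], simp add: field_simps)+
  have "cos_seq 4 = cos (pi / 4)" unfolding cos_seq_def by (rule arg_cong[of _ _ cos]) simp
  then have "sqrt 2 = 2 * cos_seq 4" by (simp add: cos_45)
  then show ?thesis by (simp add: v16_GHZ3_def inverse_threshold_def s c)
qed

lemma inverse_threshold_bounds: "203416 / 100000 \<le> inverse_threshold" "inverse_threshold \<le> 203419 / 100000"
proof -
  show "203416 / 100000 \<le> inverse_threshold"
    unfolding inverse_threshold_def by (simp add: field_simps; use cos_seq_bounds in linarith)
  show "inverse_threshold \<le> 203419 / 100000"
    unfolding inverse_threshold_def by (simp add: field_simps; use cos_seq_bounds in linarith)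
qed

lemma dual_cos_seq: "(\<Sum>s\<in>I16. of_int (dual s) * cos_seq s) = 7815616278 * inverse_threshold"
  unfolding sum_I16 dual_values cos_seq_reduce inverse_threshold_def by (simp add: field_simps)

text \<open>For fixed \<open>x\<close> and \<open>y\<close> the sum over \<open>z\<close> covers a
  full period of the product, so it equals \<open>dual_cos_seq\<close> for each of the 256
  pairs.\<close>

lemma trilinear_cos_seq:
  "(\<Sum>x\<in>I16. \<Sum>y\<in>I16. \<Sum>z\<in>I16. of_int (dual (x + y + z)) * cos_seq (x + y + z)) = 2000797767168 * inverse_threshold"
proof -
  have per: "real_of_int (dual (z + 16)) * cos_seq (z + 16) = of_int (dual z) * cos_seq z" for z
    by (simp add: antiperiodicD[OF antiperiodic_dual] antiperiodicD[OF antiperiodic_cos_seq])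
  have "(\<Sum>z\<in>I16. of_int (dual (x + y + z)) * cos_seq (x + y + z)) = 7815616278 * inverse_threshold" for x y
    using sum_periodic_shift[of "\<lambda>z. of_int (dual z) * cos_seq z" "x + y"] per
    unfolding dual_cos_seq[symmetric] by (simp add: add_ac)
  then show ?thesis by simp
qed

text \<open>Numbering from 0 makes the angle proportional to the index, so sums of angles become
  sums of integers.\<close>

definition direction :: "int \<Rightarrow> real^3" where
  "direction x = equatorial_direction 16 (nat (x + 1))"

lemma direction_image: "direction ` I16 = equatorial_direction 16 ` {1..16}"
proof -
  have "(\<lambda>x. nat (x + 1)) ` I16 = {1..16}"
  proof
    show "{1..16} \<subseteq> (\<lambda>x. nat (x + 1)) ` I16"
      by (rule subsetI, rule_tac x = "int x - 1" in image_eqI) auto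
  qed auto
  then have "equatorial_direction 16 ` (\<lambda>x. nat (x + 1)) ` I16 = equatorial_direction 16 ` {1..16}" by simp
  then show ?thesis by (simp add: image_image direction_def)
qed

lemma GHZ_prob_direction:
  assumes "\<And>n. k n \<in> I16"
  shows "GHZ_prob v a (\<lambda>n. direction (k n)) = of_real ((1 + v * (a 1 * a 2 * a 3) * cos_seq (k 1 + k 2 + k 3)) / 8)"
proof -
  have k: "(real (nat (k n + 1)) - 1) * pi / real 16 = pi * of_int (k n) / 16" for n
    using assms[of n] by simp
  have "GHZ_prob v a (\<lambda>n. direction (k n))
    = of_real ((1 + v * (\<Prod>n\<in>UNIV. a n) * cos (\<Sum>n\<in>UNIV. pi * of_int (k n) / 16)) / 8)"
    unfolding direction_def GHZ_prob_equatorial k ..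
  also have "(\<Sum>n\<in>UNIV. pi * of_int (k n) / 16) = pi * of_int (k 1 + k 2 + k 3) / 16"
    by (simp add: sum_3 algebra_simps add_divide_distrib)
  finally show ?thesis by (simp only: prod_UNIV_3 cos_seq_def)
qed

text \<open>The pointwise bound \<open>trilinear_dual_real_le\<close> is averaged over the hidden
  variable. Allowing any \<open>S\<close> that contains the 16 directions lets the same bound serve
  the whole sphere.\<close>

lemma local_visibility_le:
  assumes model: "is_local_model M q S v" and S: "direction ` I16 \<subseteq> S"
  shows "v \<le> v16_GHZ3"
proof -
  have ps: "prob_space M"
    and meas: "\<And>n x a. x \<in> S \<Longrightarrow> a \<in> {1, - 1} \<Longrightarrow> (\<lambda>\<omega>. q n \<omega> a x) \<in> borel_measurable M"
    and pr: "\<And>n x \<omega>. \<omega> \<in> space M \<Longrightarrow> x \<in> S \<Longrightarrow>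
        0 \<le> q n \<omega> 1 x \<and> 0 \<le> q n \<omega> (- 1) x \<and> q n \<omega> 1 x + q n \<omega> (- 1) x = 1"
    and rep: "\<And>a x. (\<And>n. a n \<in> {1, - 1} \<and> x n \<in> S) \<Longrightarrow>
        GHZ_prob v a x = complex_of_real (\<integral>\<omega>. (\<Prod>n\<in>UNIV. q n \<omega> (a n) (x n)) \<partial>M)"
    using model unfolding is_local_model_def by blast+
  interpret prob_space M by (rule ps)
  have dS: "direction x \<in> S" if "x \<in> I16" for x using S that by blast
  define p where "p = (\<lambda>n \<omega> (s :: real) x. q n \<omega> s (direction x))"
  define A where "A = (\<lambda>n \<omega> x. p n \<omega> 1 x - p n \<omega> (- 1) x)"
  have p_meas: "(\<lambda>\<omega>. p n \<omega> s x) \<in> borel_measurable M" if "x \<in> I16" "s \<in> {1, - 1}" for n s x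
    unfolding p_def using meas[OF dS[OF that(1)] that(2)] .
  have p_bounds: "0 \<le> p n \<omega> s x \<and> p n \<omega> s x \<le> 1" if "\<omega> \<in> space M" "x \<in> I16" "s \<in> {1, - 1}" for n \<omega> s x
    using pr[OF that(1) dS[OF that(2)], of n] that(3) unfolding p_def by auto
  have A_bound: "\<bar>A n \<omega> x\<bar> \<le> 1" if "\<omega> \<in> space M" "x \<in> I16" for n \<omega> x
    using pr[OF that(1) dS[OF that(2)], of n] unfolding A_def p_def by auto
  have int_p: "integrable M (\<lambda>\<omega>. p 1 \<omega> s x * p 2 \<omega> t y * p 3 \<omega> u z)"
    if "x \<in> I16" "y \<in> I16" "z \<in> I16" "s \<in> {1, - 1}" "t \<in> {1, - 1}" "u \<in> {1, - 1}" for x y z s t u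
  proof (rule integrable_const_bound[where B = 1])
    show "AE \<omega> in M. norm (p 1 \<omega> s x * p 2 \<omega> t y * p 3 \<omega> u z) \<le> 1"
    proof (rule AE_I2)
      fix \<omega> assume w: "\<omega> \<in> space M"
      have b: "0 \<le> p 1 \<omega> s x \<and> p 1 \<omega> s x \<le> 1" "0 \<le> p 2 \<omega> t y \<and> p 2 \<omega> t y \<le> 1" "0 \<le> p 3 \<omega> u z \<and> p 3 \<omega> u z \<le> 1"
        using p_bounds[OF w] that by auto
      then show "norm (p 1 \<omega> s x * p 2 \<omega> t y * p 3 \<omega> u z) \<le> 1"
        by (simp add: abs_mult mult_le_one)
    qed
  qed (intro borel_measurable_times p_meas that)
  have prob_eq: "(\<integral>\<omega>. p 1 \<omega> s x * p 2 \<omega> t y * p 3 \<omega> u z \<partial>M) = (1 + v * (s * t * u) * cos_seq (x + y + z)) / 8"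
    if "x \<in> I16" "y \<in> I16" "z \<in> I16" "s \<in> {1, - 1}" "t \<in> {1, - 1}" "u \<in> {1, - 1}" for x y z s t u
  proof -
    define a where "a = (\<lambda>n :: 3. if n = 1 then s else if n = 2 then t else u)"
    define k where "k = (\<lambda>n :: 3. if n = 1 then x else if n = 2 then y else z)"
    have a: "a 1 = s" "a 2 = t" "a 3 = u" and k: "k 1 = x" "k 2 = y" "k 3 = z"
      by (simp_all add: a_def k_def)
    have kI: "k n \<in> I16" for n using that by (simp add: k_def)
    have "a n \<in> {1, - 1} \<and> direction (k n) \<in> S" for n using that dS[OF kI] by (simp add: a_def)
    from rep[of a "\<lambda>n. direction (k n)", OF this]
    have "GHZ_prob v a (\<lambda>n. direction (k n)) = of_real (\<integral>\<omega>. (\<Prod>n\<in>UNIV. q n \<omega> (a n) (direction (k n))) \<partial>M)" .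
    then have "(1 + v * (s * t * u) * cos_seq (x + y + z)) / 8 = (\<integral>\<omega>. (\<Prod>n\<in>UNIV. q n \<omega> (a n) (direction (k n))) \<partial>M)"
      unfolding GHZ_prob_direction[OF kI] a k of_real_eq_iff .
    then show ?thesis unfolding prod_UNIV_3 a k p_def by simp
  qed
  \<comment> \<open>A local model prescribes outcome probabilities only; the signed sum over the
    eight outcome triples recovers the full correlator from them.\<close>
  have A_expand: "A 1 \<omega> x * A 2 \<omega> y * A 3 \<omega> z = (\<Sum>(s, t, u)\<in>{1, - 1} \<times> {1, - 1} \<times> {1, - 1}. s * t * u * (p 1 \<omega> s x * p 2 \<omega> t y * p 3 \<omega> u z))" for \<omega> x y z
    unfolding A_def by (simp flip: sum.cartesian_product) (simp add: algebra_simps)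
  have A_int: "integrable M (\<lambda>\<omega>. A 1 \<omega> x * A 2 \<omega> y * A 3 \<omega> z)"
    and A_eq: "(\<integral>\<omega>. A 1 \<omega> x * A 2 \<omega> y * A 3 \<omega> z \<partial>M) = v * cos_seq (x + y + z)"
    if "x \<in> I16" "y \<in> I16" "z \<in> I16" for x y z
  proof -
    show "integrable M (\<lambda>\<omega>. A 1 \<omega> x * A 2 \<omega> y * A 3 \<omega> z)"
      unfolding A_expand using that by (intro Bochner_Integration.integrable_sum) (auto intro!: integrable_mult_right int_p simp del: mult_minus_left mult_1_left)
    have "(\<integral>\<omega>. A 1 \<omega> x * A 2 \<omega> y * A 3 \<omega> z \<partial>M)
      = (\<Sum>(s, t, u)\<in>{1, - 1} \<times> {1, - 1} \<times> {1, - 1}. \<integral>\<omega>. s * t * u * (p 1 \<omega> s x * p 2 \<omega> t y * p 3 \<omega> u z) \<partial>M)"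
      unfolding A_expand using that
      by (subst Bochner_Integration.integral_sum) (auto intro!: integrable_mult_right int_p sum.cong simp del: mult_minus_left mult_1_left)
    also have "\<dots> = (\<Sum>(s, t, u)\<in>{1, - 1} \<times> {1, - 1} \<times> {1, - 1}. s * t * u * ((1 + v * (s * t * u) * cos_seq (x + y + z)) / 8))"
      using that by (intro sum.cong refl) (auto simp: prob_eq)
    also have "\<dots> = v * cos_seq (x + y + z)"
      by (simp flip: sum.cartesian_product) (simp add: field_simps)
    finally show "(\<integral>\<omega>. A 1 \<omega> x * A 2 \<omega> y * A 3 \<omega> z \<partial>M) = v * cos_seq (x + y + z)" .
  qed
  let ?F = "\<lambda>x. real_of_int (dual x)"
  let ?T = "\<lambda>\<omega>. trilinear ?F (A 1 \<omega>) (A 2 \<omega>) (A 3 \<omega>)"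
  have T_eq: "?T \<omega> = (\<Sum>x\<in>I16. \<Sum>y\<in>I16. \<Sum>z\<in>I16. ?F (x + y + z) * (A 1 \<omega> x * A 2 \<omega> y * A 3 \<omega> z))" for \<omega>
    by (simp add: trilinear_def mult.assoc)
  have T_int: "integrable M ?T"
    unfolding T_eq by (intro Bochner_Integration.integrable_sum integrable_mult_right A_int)
  have "v * (2000797767168 * inverse_threshold)
    = (\<Sum>x\<in>I16. \<Sum>y\<in>I16. \<Sum>z\<in>I16. ?F (x + y + z) * (v * cos_seq (x + y + z)))"
    unfolding trilinear_cos_seq[symmetric] sum_distrib_left by (simp add: mult.left_commute)
  also have "\<dots> = (\<Sum>x\<in>I16. \<Sum>y\<in>I16. \<Sum>z\<in>I16. ?F (x + y + z) * (\<integral>\<omega>. A 1 \<omega> x * A 2 \<omega> y * A 3 \<omega> z \<partial>M))"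
    by (intro sum.cong refl) (simp add: A_eq)
  also have "\<dots> = (\<integral>\<omega>. ?T \<omega> \<partial>M)"
    unfolding T_eq
    by (subst Bochner_Integration.integral_sum, intro Bochner_Integration.integrable_sum integrable_mult_right A_int, assumption+,
        rule sum.cong[OF refl],
        subst Bochner_Integration.integral_sum, intro Bochner_Integration.integrable_sum integrable_mult_right A_int, assumption+,
        rule sum.cong[OF refl],
        subst Bochner_Integration.integral_sum, intro integrable_mult_right A_int, assumption+,
        rule sum.cong[OF refl]) simp
  also have "\<dots> \<le> (\<integral>\<omega>. 2000797767168 \<partial>M)"
    by (intro integral_mono T_int) (auto intro!: trilinear_dual_real_le A_bound)
  also have "\<dots> = 2000797767168" by (simp add: prob_space)
  finally have "v * inverse_threshold \<le> 1" by simp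
  moreover have "inverse_threshold > 0" using inverse_threshold_bounds(1) by simp
  ultimately show ?thesis by (simp add: v16_GHZ3_eq inverse_eq_divide pos_le_divide_eq)
qed

section \<open>The local model\<close>

definition inverse_unit :: "int \<Rightarrow> int" where
  "inverse_unit u = (if u = 3 then 11 else if u = 5 then 13 else if u = 7 then 9 else if u = 9 then 7
     else if u = 11 then 3 else if u = 13 then 5 else u)"

text \<open>For these three dilations the linear system yields a negative coefficient; negating one
  party's answers makes the weight positive.\<close>

definition unit_sign :: "int \<Rightarrow> int" where
  "unit_sign u = (if u \<in> {5, 13, 15} then - 1 else 1)"

text \<open>
  The weights solve the linear system that expresses the cosine through the correlators of the dilated interval
  strategies. Dilating by \<open>u\<close> permutes the correlators, so one row of the inverse matrix, dilated by the inverse of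
  \<open>u\<close> modulo 32 (up to sign), gives all of them.
\<close>

definition weight_num :: "int \<Rightarrow> real" where
  "weight_num u = of_int (unit_sign u) * (let v = inverse_unit u in
     3907808139 + 7326347904 * cos_seq v + 6845795280 * cos_seq (2 * v) + 6575947392 * cos_seq (3 * v)
     + 5210410852 * cos_seq (4 * v) + 4070596608 * cos_seq (5 * v) + 3194704464 * cos_seq (6 * v)
     + 1227239424 * cos_seq (7 * v))"

definition weight :: "int \<Rightarrow> real" where
  "weight u = weight_num u / 15631232556"

lemma weight_num_values:
  "weight_num 1 = 3907808139 + 7326347904 * cos_seq 1 + 6845795280 * cos_seq 2 + 6575947392 * cos_seq 3 + 5210410852 * cos_seq 4 + 4070596608 * cos_seq 5 + 3194704464 * cos_seq 6 + 1227239424 * cos_seq 7"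
  "weight_num 3 = 3907808139 + 6575947392 * cos_seq 1 + 3194704464 * cos_seq 2 - 1227239424 * cos_seq 3 - 5210410852 * cos_seq 4 - 7326347904 * cos_seq 5 - 6845795280 * cos_seq 6 - 4070596608 * cos_seq 7"
  "weight_num 5 = - 3907808139 - 4070596608 * cos_seq 1 + 3194704464 * cos_seq 2 + 7326347904 * cos_seq 3 + 5210410852 * cos_seq 4 - 1227239424 * cos_seq 5 - 6845795280 * cos_seq 6 - 6575947392 * cos_seq 7"
  "weight_num 7 = 3907808139 + 1227239424 * cos_seq 1 - 6845795280 * cos_seq 2 - 4070596608 * cos_seq 3 + 5210410852 * cos_seq 4 + 6575947392 * cos_seq 5 - 3194704464 * cos_seq 6 - 7326347904 * cos_seq 7"
  "weight_num 9 = 3907808139 - 1227239424 * cos_seq 1 - 6845795280 * cos_seq 2 + 4070596608 * cos_seq 3 + 5210410852 * cos_seq 4 - 6575947392 * cos_seq 5 - 3194704464 * cos_seq 6 + 7326347904 * cos_seq 7"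
  "weight_num 11 = 3907808139 - 4070596608 * cos_seq 1 - 3194704464 * cos_seq 2 + 7326347904 * cos_seq 3 - 5210410852 * cos_seq 4 - 1227239424 * cos_seq 5 + 6845795280 * cos_seq 6 - 6575947392 * cos_seq 7"
  "weight_num 13 = - 3907808139 + 6575947392 * cos_seq 1 - 3194704464 * cos_seq 2 - 1227239424 * cos_seq 3 + 5210410852 * cos_seq 4 - 7326347904 * cos_seq 5 + 6845795280 * cos_seq 6 - 4070596608 * cos_seq 7"
  "weight_num 15 = - 3907808139 + 7326347904 * cos_seq 1 - 6845795280 * cos_seq 2 + 6575947392 * cos_seq 3 - 5210410852 * cos_seq 4 + 4070596608 * cos_seq 5 - 3194704464 * cos_seq 6 + 1227239424 * cos_seq 7"
  by (simp_all add: weight_num_def unit_sign_def inverse_unit_def cos_seq_mod cos_seq_reduce)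

lemma sum_units: "sum f units = f 1 + f 3 + f 5 + f 7 + f 9 + f 11 + f 13 + (f 15 :: 'a::comm_monoid_add)"
  by (simp add: units_def add.assoc)

text \<open>This is what turns the solution of the linear system into a probability distribution.
  The smallest weight, at 9, is about 10^-4.\<close>

lemma weight_nonneg:
  assumes "u \<in> units" shows "0 \<le> weight u"
proof -
  have "0 \<le> weight 1" unfolding weight_def weight_num_values
    by (rule divide_nonneg_nonneg) (use cos_seq_bounds in linarith)+
  moreover have "0 \<le> weight 3" unfolding weight_def weight_num_values
    by (rule divide_nonneg_nonneg) (use cos_seq_bounds in linarith)+
  moreover have "0 \<le> weight 5" unfolding weight_def weight_num_values
    by (rule divide_nonneg_nonneg) (use cos_seq_bounds in linarith)+
  moreover have "0 \<le> weight 7" unfolding weight_def weight_num_values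
    by (rule divide_nonneg_nonneg) (use cos_seq_bounds in linarith)+
  moreover have "0 \<le> weight 9" unfolding weight_def weight_num_values
    by (rule divide_nonneg_nonneg) (use cos_seq_bounds in linarith)+
  moreover have "0 \<le> weight 11" unfolding weight_def weight_num_values
    by (rule divide_nonneg_nonneg) (use cos_seq_bounds in linarith)+
  moreover have "0 \<le> weight 13" unfolding weight_def weight_num_values
    by (rule divide_nonneg_nonneg) (use cos_seq_bounds in linarith)+
  moreover have "0 \<le> weight 15" unfolding weight_def weight_num_values
    by (rule divide_nonneg_nonneg) (use cos_seq_bounds in linarith)+
  ultimately show ?thesis using assms by (auto simp: units_def)
qed

text \<open>The weights reproduce the full cosine but have total mass
  \<open>inverse_threshold\<close>. Normalising the mass to 1 scales the cosine, and so the
  visibility, to \<open>v16_GHZ3\<close>.\<close>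

lemma sum_weight: "(\<Sum>u\<in>units. weight u) = inverse_threshold"
proof -
  have "(\<Sum>u\<in>units. weight_num u) = 15631232556 * inverse_threshold"
    unfolding sum_units weight_num_values inverse_threshold_def by (simp add: field_simps)
  then show ?thesis by (simp add: weight_def flip: sum_divide_distrib)
qed

section \<open>Triple convolution of the interval sequence\<close>

definition interval_corr :: "int \<Rightarrow> int" where
  "interval_corr s = (\<Sum>x\<in>I16. \<Sum>y\<in>I16. base_seq 16 x * base_seq 16 y * base_seq 16 (s - x - y))"

text \<open>
  The triple convolution is symmetric about \<open>22.5 = 3 * 7.5\<close>; averaging the two shifts 22 and 23 makes it even.
\<close>

definition interval_corr_sym :: "int \<Rightarrow> int" where
  "interval_corr_sym n = interval_corr (n + 22) + interval_corr (- n + 22)"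

lemma antiperiodic_interval_corr: "antiperiodic interval_corr"
proof -
  have "base_seq 16 (s + 16 - x - y) = - base_seq 16 (s - x - y)" for s x y
    using antiperiodicD[OF antiperiodic_base_seq, of 16 "s - x - y"] by (simp add: algebra_simps)
  then show ?thesis by (simp add: antiperiodic_def interval_corr_def sum_negf)
qed

lemma antiperiodic_interval_corr_sym: "antiperiodic interval_corr_sym"
  using antiperiodicD[OF antiperiodic_interval_corr] antiperiodic_minus[OF antiperiodic_interval_corr]
  unfolding antiperiodic_def interval_corr_sym_def by (smt (verit))

text \<open>Negating the argument turns the convolution into the iterated correlation that
  \<open>base_sum\<close> evaluates by running sums.\<close>

lemma interval_corr_base_conv:
  "interval_corr (- z) = base_conv 16 (base_conv 16 (\<lambda>x. base_seq 16 (- x))) z"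
proof -
  have "- (y + (x + z)) = - z - x - y" for x y :: int by simp
  then show ?thesis
    unfolding interval_corr_def base_conv_def sum_distrib_left by (simp only: mult.assoc)
qed

lemma interval_corr_list:
  "map (\<lambda>z. interval_corr (- z)) [0..15] = [-44, -16, 16, 44, 68, 88, 104, 116, 124, 128, 128, 124, 116, 104, 88, 68]"
proof -
  have f: "antiperiodic (\<lambda>x. base_seq 16 (- x))"
    using antiperiodic_reflect[OF antiperiodic_base_seq, of 16 0] by simp
  have "map (\<lambda>z. interval_corr (- z)) [0..15] = seq_list (base_conv 16 (base_conv 16 (\<lambda>x. base_seq 16 (- x))))"
    by (simp add: interval_corr_base_conv seq_list_def)
  also have "\<dots> = base_sum 16 (base_sum 16 (seq_list (\<lambda>x. base_seq 16 (- x))))"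
    by (simp add: base_sum_seq_list f antiperiodic_base_conv)
  also have "\<dots> = [-44, -16, 16, 44, 68, 88, 104, 116, 124, 128, 128, 124, 116, 104, 88, 68]"
    by code_simp
  finally show ?thesis .
qed

lemma interval_corr_values:
  "interval_corr 0 = -44"
  "interval_corr (- 1) = -16"
  "interval_corr (- 2) = 16"
  "interval_corr (- 3) = 44"
  "interval_corr (- 4) = 68"
  "interval_corr (- 5) = 88"
  "interval_corr (- 6) = 104"
  "interval_corr (- 7) = 116"
  "interval_corr (- 8) = 124"
  "interval_corr (- 9) = 128"
  "interval_corr (- 10) = 128"
  "interval_corr (- 11) = 124"
  "interval_corr (- 12) = 116"
  "interval_corr (- 13) = 104"
  "interval_corr (- 14) = 88"
  "interval_corr (- 15) = 68"
  using interval_corr_list by (simp_all add: upto_rec1)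

lemma interval_corr_numeral:
  "interval_corr (numeral n) = - interval_corr (numeral n - 16)"
  using antiperiodic_minus[OF antiperiodic_interval_corr, of "numeral n"] by simp

lemma interval_corr_sym_values:
  "interval_corr_sym 0 = 256"
  "interval_corr_sym 1 = 252"
  "interval_corr_sym 2 = 240"
  "interval_corr_sym 3 = 220"
  "interval_corr_sym 4 = 192"
  "interval_corr_sym 5 = 156"
  "interval_corr_sym 6 = 112"
  "interval_corr_sym 7 = 60"
  "interval_corr_sym 8 = 0"
  "interval_corr_sym 9 = -60"
  "interval_corr_sym 10 = -112"
  "interval_corr_sym 11 = -156"
  "interval_corr_sym 12 = -192"
  "interval_corr_sym 13 = -220"
  "interval_corr_sym 14 = -240"
  "interval_corr_sym 15 = -252"
  using antiperiodic_minus[OF antiperiodic_interval_corr, of 1]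
  by (simp_all add: interval_corr_sym_def interval_corr_numeral interval_corr_values)

lemma interval_corr_sym_mod:
  "(16::int) \<le> numeral n \<Longrightarrow> interval_corr_sym (numeral n) = - interval_corr_sym (numeral n - 16)"
  using antiperiodic_minus[OF antiperiodic_interval_corr_sym, of "numeral n"] by simp

text \<open>By antiperiodicity 16 values of \<open>s\<close> suffice, where the weights solve the
  linear system. The factor 512 counts the 256 pairs of shifts for each of two reflections.\<close>

lemma weighted_interval_corr:
  "(\<Sum>u\<in>units. weight u * of_int (unit_sign u * interval_corr_sym (u * s))) = 512 * cos_seq s"
proof (rule antiperiodic_eqI[of "\<lambda>s. \<Sum>u\<in>units. weight u * of_int (unit_sign u * interval_corr_sym (u * s))"
      "\<lambda>s. 512 * cos_seq s"])
  have "antiperiodic (\<lambda>s. interval_corr_sym (u * s))" if "u \<in> units" for u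
    using that by (intro antiperiodic_dilate[OF antiperiodic_interval_corr_sym]) (auto simp: units_def)
  then show "antiperiodic (\<lambda>s. \<Sum>u\<in>units. weight u * of_int (unit_sign u * interval_corr_sym (u * s)))"
    by (simp add: antiperiodic_def sum_negf)
  show "antiperiodic (\<lambda>s. 512 * cos_seq s)"
    using antiperiodicD[OF antiperiodic_cos_seq] by (simp add: antiperiodic_def)
  fix s :: int assume "s \<in> I16"
  then have "s = 0 \<or> s = 1 \<or> s = 2 \<or> s = 3 \<or> s = 4 \<or> s = 5 \<or> s = 6 \<or> s = 7 \<or> s = 8 \<or> s = 9 \<or> s = 10
      \<or> s = 11 \<or> s = 12 \<or> s = 13 \<or> s = 14 \<or> s = 15"
    unfolding I16_eq insert_iff empty_iff by simp
  then have "(\<Sum>u\<in>units. weight_num u * of_int (unit_sign u * interval_corr_sym (u * s))) = 15631232556 * (512 * cos_seq s)"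
    unfolding sum_units
    by (elim disjE; hypsubst; simp add: unit_sign_def interval_corr_sym_values interval_corr_sym_mod cos_seq_reduce
        weight_num_values algebra_simps)
  then show "(\<Sum>u\<in>units. weight u * of_int (unit_sign u * interval_corr_sym (u * s))) = 512 * cos_seq s"
    by (simp add: weight_def flip: sum_divide_distrib)
qed

lemma sum_two_periods: "(\<Sum>t\<in>{0..<32::int}. f t) = (\<Sum>t\<in>I16. f t + (f (t + 16) :: 'a::comm_monoid_add))"
proof -
  have "(\<lambda>t. t + 16) ` I16 = {16..<32}" by simp
  moreover have "inj_on (\<lambda>t. t + 16 :: int) I16" by (simp add: inj_on_def)
  ultimately have "(\<Sum>t\<in>I16. f (t + 16)) = (\<Sum>t\<in>{16..<32}. f t)"
    using sum.reindex[of "\<lambda>t. t + 16" I16 f] by simp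
  moreover have "(\<Sum>t\<in>{0..<32}. f t) = (\<Sum>t\<in>I16. f t) + (\<Sum>t\<in>{16..<32}. f t)"
  proof -
    have "{0..<32::int} = I16 \<union> {16..<32}" by auto
    then show ?thesis by (simp add: sum.union_disjoint)
  qed
  ultimately show ?thesis by (simp add: sum.distrib)
qed

definition real_base :: "int \<Rightarrow> real" where "real_base x = of_int (base_seq 16 x)"

lemma real_base_cases: "real_base x = 1 \<or> real_base x = - 1"
  using sign_seq_base_seq[of 16] by (auto simp: real_base_def sign_seq_def)

lemma antiperiodic_real_base: "antiperiodic real_base"
  using antiperiodic_base_seq[of 16] by (simp add: antiperiodic_def real_base_def)

lemma sum_shifted_triple:
  "(\<Sum>s\<in>I16. \<Sum>t\<in>I16. real_base (i + s) * real_base (j + t) * real_base (k + 22 - s - t))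
    = of_int (interval_corr (i + j + k + 22))"
proof -
  have ap: "real_base (x + 16) = - real_base x" "real_base (y - (x + 16)) = - real_base (y - x)" for x y
    using antiperiodicD[OF antiperiodic_real_base, of x] antiperiodic_minus[OF antiperiodic_real_base, of "y - x"]
    by (simp_all add: algebra_simps)
  have "(\<Sum>t\<in>I16. real_base (i + s) * real_base (t + j) * real_base (k + 22 - s + j - (t + j)))
      = (\<Sum>t\<in>I16. real_base (i + s) * real_base t * real_base (k + 22 - s + j - t))" for s
    by (rule sum_periodic_shift[of "\<lambda>t. real_base (i + s) * real_base t * real_base (k + 22 - s + j - t)"])
      (simp only: ap sum_negf mult_minus_left mult_minus_right minus_minus)
  then have "(\<Sum>s\<in>I16. \<Sum>t\<in>I16. real_base (i + s) * real_base (j + t) * real_base (k + 22 - s - t))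
    = (\<Sum>s\<in>I16. \<Sum>t\<in>I16. real_base (s + i) * real_base t * real_base (k + 22 + j + i - t - (s + i)))"
    by (simp add: algebra_simps)
  also have "\<dots> = (\<Sum>s\<in>I16. \<Sum>t\<in>I16. real_base s * real_base t * real_base (k + 22 + j + i - t - s))"
    by (rule sum_periodic_shift[of "\<lambda>s. \<Sum>t\<in>I16. real_base s * real_base t * real_base (k + 22 + j + i - t - s)"])
      (simp only: ap sum_negf mult_minus_left mult_minus_right minus_minus)
  also have "\<dots> = of_int (interval_corr (i + j + k + 22))"
    unfolding interval_corr_def of_int_sum of_int_mult real_base_def[symmetric]
    by (simp add: algebra_simps)
  finally show ?thesis .
qed

text \<open>
  Shifting \<open>s\<close> by a half period flips the signs of the first and third outcomes, shifting \<open>t\<close> those of the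
  second and third, so that all one- and two-party correlations average out.
\<close>

lemma sum_product_responses:
  "(\<Sum>s\<in>{0..<32}. \<Sum>t\<in>{0..<32}. (1 + a * real_base (i + s)) / 2 * ((1 + b * real_base (j + t)) / 2)
      * ((1 + c * (e * real_base (k + 22 - s - t))) / 2))
    = 128 + a * b * c * e * of_int (interval_corr (i + j + k + 22)) / 2"
proof -
  let ?P = "\<lambda>s t. (1 + a * real_base (i + s)) / 2 * ((1 + b * real_base (j + t)) / 2)
      * ((1 + c * (e * real_base (k + 22 - s - t))) / 2)"
  have flip: "real_base (i + (s + 16)) = - real_base (i + s)" "real_base (j + (t + 16)) = - real_base (j + t)"
    "real_base (k + 22 - (s + 16) - t) = - real_base (k + 22 - s - t)"
    "real_base (k + 22 - s - (t + 16)) = - real_base (k + 22 - s - t)"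
    "real_base (k + 22 - (s + 16) - (t + 16)) = real_base (k + 22 - s - t)" for s t
    using antiperiodicD[OF antiperiodic_real_base, of "i + s"] antiperiodicD[OF antiperiodic_real_base, of "j + t"]
      antiperiodic_minus[OF antiperiodic_real_base, of "k + 22 - s - t"]
      antiperiodic_minus[OF antiperiodic_real_base, of "k + 22 - s - t - 16"]
    by (simp_all add: algebra_simps)
  have "(\<Sum>s\<in>{0..<32}. \<Sum>t\<in>{0..<32}. ?P s t)
    = (\<Sum>s\<in>I16. \<Sum>t\<in>I16. (?P s t + ?P s (t + 16)) + (?P (s + 16) t + ?P (s + 16) (t + 16)))"
    unfolding sum_two_periods by (simp only: sum.distrib)
  also have "\<dots> = (\<Sum>s\<in>I16. \<Sum>t\<in>I16. 1 / 2
      + a * b * c * e / 2 * (real_base (i + s) * real_base (j + t) * real_base (k + 22 - s - t)))"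
    unfolding flip by (intro sum.cong refl) (simp add: field_simps)
  also have "\<dots> = 128 + a * b * c * e / 2 * (\<Sum>s\<in>I16. \<Sum>t\<in>I16. real_base (i + s) * real_base (j + t) * real_base (k + 22 - s - t))"
    by (simp add: sum.distrib sum_distrib_left)
  finally show ?thesis unfolding sum_shifted_triple by simp
qed

section \<open>The hidden variables and their strategies\<close>

definition hidden :: "(int \<times> int \<times> int \<times> int) set" where
  "hidden = units \<times> {1, - 1} \<times> {0..<32} \<times> {0..<32}"

text \<open>Since 2048 = 2 * 32 * 32, the reflection \<open>r\<close> and the shifts
  \<open>s\<close> and \<open>t\<close> are uniform; only the dilation \<open>u\<close> is
  weighted.\<close>

definition hidden_weight :: "int \<times> int \<times> int \<times> int \<Rightarrow> real" where
  "hidden_weight = (\<lambda>(u, r, s, t). v16_GHZ3 * weight u / 2048)"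

definition setting :: "real^3 \<Rightarrow> int" where
  "setting x = (SOME k. k \<in> I16 \<and> direction k = x)"

text \<open>The shifts of the three parties always add up to 22, so the averaged correlator depends
  only on the sum of the settings. The reflection \<open>r\<close> supplies the symmetrisation of
  the triple convolution.\<close>

definition strategy :: "3 \<Rightarrow> int \<times> int \<times> int \<times> int \<Rightarrow> int \<Rightarrow> real" where
  "strategy n = (\<lambda>(u, r, s, t) k. if n = 1 then real_base (r * u * k + s) else if n = 2 then real_base (r * u * k + t)
     else of_int (unit_sign u) * real_base (r * u * k + 22 - s - t))"

lemma strategy_cases: "strategy n \<omega> k = 1 \<or> strategy n \<omega> k = - 1"
proof (cases \<omega>)
  case (fields u r s t)
  show ?thesis
    using real_base_cases[of "r * u * k + s"] real_base_cases[of "r * u * k + t"]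
      real_base_cases[of "r * u * k + 22 - s - t"]
    by (auto simp: fields strategy_def unit_sign_def)
qed

lemma setting_direction:
  assumes "x \<in> direction ` I16"
  shows "setting x \<in> I16" "direction (setting x) = x"
proof -
  have "\<exists>k. k \<in> I16 \<and> direction k = x" using assms by blast
  from someI_ex[OF this] show "setting x \<in> I16" "direction (setting x) = x"
    by (auto simp: setting_def)
qed

lemma v16_pos: "v16_GHZ3 > 0"
  using inverse_threshold_bounds(1) by (simp add: v16_GHZ3_eq)

lemma v16_inverse: "v16_GHZ3 * inverse_threshold = 1"
  using inverse_threshold_bounds(1) by (simp add: v16_GHZ3_eq)

lemma hidden_weight_nonneg: "\<omega> \<in> hidden \<Longrightarrow> 0 \<le> hidden_weight \<omega>"
  using weight_nonneg v16_pos by (auto simp: hidden_def hidden_weight_def)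

lemma sum_hidden:
  "(\<Sum>\<omega>\<in>hidden. f \<omega>) = (\<Sum>u\<in>units. \<Sum>r\<in>{1, - 1}. \<Sum>s\<in>{0..<32}. \<Sum>t\<in>{0..<32}. f (u, r, s, t))"
  unfolding hidden_def sum.cartesian_product by (intro sum.cong) auto

lemma sum_hidden_weight: "(\<Sum>\<omega>\<in>hidden. hidden_weight \<omega>) = 1"
  unfolding sum_hidden by (simp add: hidden_weight_def sum_weight v16_inverse flip: sum_divide_distrib sum_distrib_left)

lemma expectation_strategies:
  "(\<Sum>\<omega>\<in>hidden. hidden_weight \<omega> * ((1 + a * strategy 1 \<omega> i) / 2 * ((1 + b * strategy 2 \<omega> j) / 2)
      * ((1 + c * strategy 3 \<omega> k) / 2)))
    = (1 + v16_GHZ3 * (a * b * c) * cos_seq (i + j + k)) / 8"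
proof -
  have inner: "(\<Sum>s\<in>{0..<32}. \<Sum>t\<in>{0..<32}. hidden_weight (u, r, s, t) *
      ((1 + a * strategy 1 (u, r, s, t) i) / 2 * ((1 + b * strategy 2 (u, r, s, t) j) / 2)
      * ((1 + c * strategy 3 (u, r, s, t) k) / 2)))
    = v16_GHZ3 * weight u / 2048 * (128 + a * b * c * of_int (unit_sign u) * of_int (interval_corr (r * (u * (i + j + k)) + 22)) / 2)"
    for u r
  proof -
    have strat: "strategy 1 (u, r, s, t) i = real_base (r * u * i + s)" "strategy 2 (u, r, s, t) j = real_base (r * u * j + t)"
      "strategy 3 (u, r, s, t) k = of_int (unit_sign u) * real_base (r * u * k + 22 - s - t)" for s t
      by (simp_all add: strategy_def)
    have "r * u * i + r * u * j + r * u * k + 22 = r * (u * (i + j + k)) + 22" by (simp add: algebra_simps)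
    then show ?thesis
      unfolding hidden_weight_def prod.case strat sum_distrib_left[symmetric] sum_product_responses by simp
  qed
  \<comment> \<open>The reflections \<open>r = 1\<close> and \<open>r = - 1\<close> give the two
    terms of \<open>interval_corr_sym\<close>.\<close>
  have "(\<Sum>r\<in>{1, - 1}. v16_GHZ3 * weight u / 2048
      * (128 + a * b * c * of_int (unit_sign u) * of_int (interval_corr (r * (u * (i + j + k)) + 22)) / 2))
    = v16_GHZ3 / 8 * weight u + v16_GHZ3 * (a * b * c) / 4096 * (weight u * of_int (unit_sign u * interval_corr_sym (u * (i + j + k))))" for u
    by (simp add: interval_corr_sym_def field_simps)
  then have "(\<Sum>\<omega>\<in>hidden. hidden_weight \<omega> * ((1 + a * strategy 1 \<omega> i) / 2 * ((1 + b * strategy 2 \<omega> j) / 2)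
      * ((1 + c * strategy 3 \<omega> k) / 2)))
    = v16_GHZ3 / 8 * (\<Sum>u\<in>units. weight u)
      + v16_GHZ3 * (a * b * c) / 4096 * (\<Sum>u\<in>units. weight u * of_int (unit_sign u * interval_corr_sym (u * (i + j + k))))"
    unfolding sum_hidden inner by (simp only: sum.distrib sum_distrib_left)
  also have "\<dots> = (1 + v16_GHZ3 * (a * b * c) * cos_seq (i + j + k)) / 8"
    unfolding sum_weight weighted_interval_corr using v16_inverse by (simp add: field_simps)
  finally show ?thesis .
qed

lemma finite_hidden: "finite hidden"
  by (simp add: hidden_def units_def)

lemma local_at_v16: "GHZ_local (direction ` I16) v16_GHZ3"
proof (rule GHZ_local_if_local_model)
  let ?M = "point_measure hidden hidden_weight"
  let ?q = "\<lambda>n \<omega> a x. (1 + a * strategy n \<omega> (setting x)) / 2"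
  show "is_local_model ?M ?q (direction ` I16) v16_GHZ3"
    unfolding is_local_model_def
  proof (intro conjI allI ballI impI)
    show "prob_space ?M"
    proof
      have "emeasure ?M (space ?M) = (\<Sum>\<omega>\<in>hidden. ennreal (hidden_weight \<omega>))"
        by (simp add: emeasure_point_measure_finite finite_hidden space_point_measure)
      then show "emeasure ?M (space ?M) = 1"
        by (simp add: sum_hidden_weight sum_ennreal hidden_weight_nonneg)
    qed
  next
    fix n and a :: real and x
    show "(\<lambda>\<omega>. ?q n \<omega> a x) \<in> borel_measurable ?M" by (simp add: measurable_point_measure_eq1)
  next
    fix n \<omega> and x :: "real^3"
    show "0 \<le> ?q n \<omega> 1 x" "0 \<le> ?q n \<omega> (- 1) x" "?q n \<omega> 1 x + ?q n \<omega> (- 1) x = 1"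
      using strategy_cases[of n \<omega> "setting x"] by auto
  next
    fix a :: "3 \<Rightarrow> real" and x :: "3 \<Rightarrow> real^3"
    assume ax: "\<forall>n. a n \<in> {1, - 1} \<and> x n \<in> direction ` I16"
    define k where "k = (\<lambda>n. setting (x n))"
    have k: "k n \<in> I16" "direction (k n) = x n" for n
      using setting_direction[of "x n"] ax by (auto simp: k_def)
    have "GHZ_prob v16_GHZ3 a x = of_real ((1 + v16_GHZ3 * (a 1 * a 2 * a 3) * cos_seq (k 1 + k 2 + k 3)) / 8)"
      using GHZ_prob_direction[of k v16_GHZ3 a] k by simp
    also have "(1 + v16_GHZ3 * (a 1 * a 2 * a 3) * cos_seq (k 1 + k 2 + k 3)) / 8
      = (\<Sum>\<omega>\<in>hidden. hidden_weight \<omega> * (\<Prod>n\<in>UNIV. ?q n \<omega> (a n) (x n)))"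
      unfolding expectation_strategies[symmetric] prod_UNIV_3 k_def ..
    also have "\<dots> = (\<integral>\<omega>. (\<Prod>n\<in>UNIV. ?q n \<omega> (a n) (x n)) \<partial>?M)"
      by (subst lebesgue_integral_point_measure_finite) (simp_all add: finite_hidden hidden_weight_nonneg)
    finally show "GHZ_prob v16_GHZ3 a x = complex_of_real (\<integral>\<omega>. (\<Prod>n\<in>UNIV. ?q n \<omega> (a n) (x n)) \<partial>?M)" .
  qed
qed

text \<open>Makes the set of local visibilities for the whole sphere nonempty, so that its supremum
  can be bounded by an upper bound of the set.\<close>

lemma GHZ_local_zero: "GHZ_local S 0"
proof (rule GHZ_local_if_local_model)
  show "is_local_model (uniform_count_measure {()}) (\<lambda>n \<omega> a x. 1 / 2) S 0"
    unfolding is_local_model_def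
  proof (intro conjI allI ballI impI)
    show ps: "prob_space (uniform_count_measure {()})" by (rule prob_space_uniform_count_measure) simp_all
    fix a :: "3 \<Rightarrow> real" and x :: "3 \<Rightarrow> real^3"
    have eq: "(\<integral>\<omega>. (\<Prod>n\<in>(UNIV :: 3 set). 1 / 2 :: real) \<partial>uniform_count_measure {()}) = 1 / 8"
      using prob_space.prob_space[OF ps] by (simp add: power3_eq_cube)
    show "GHZ_prob 0 a x = complex_of_real (\<integral>\<omega>. (\<Prod>n\<in>(UNIV :: 3 set). 1 / 2) \<partial>uniform_count_measure {()})"
      unfolding eq GHZ_prob_zero by simp
  qed simp_all
qed

lemma norm_direction: "norm (direction k) = 1"
  by (simp add: direction_def equatorial_direction_def norm_eq_1 inner_vec_def sum_3 flip: power2_eq_square)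

lemma GHZ_local_le:
  assumes "GHZ_local S v" "direction ` I16 \<subseteq> S"
  shows "v \<le> v16_GHZ3"
  using assms local_visibility_le unfolding GHZ_local_def by blast

theorem mainTheorem5:
  shows "GHZ_threshold (equatorial_direction 16 ` {1..16}) = v16_GHZ3
    \<and> \<bar>v16_GHZ3 - 0.49160\<bar> \<le> 0.000005
    \<and> vc_GHZ3 \<le> v16_GHZ3"
proof (intro conjI)
  have bounds: "100000 / 203419 \<le> v16_GHZ3" "v16_GHZ3 \<le> 100000 / 203416"
    using le_imp_inverse_le[OF inverse_threshold_bounds(1)] le_imp_inverse_le[OF inverse_threshold_bounds(2)]
      inverse_threshold_bounds(1)
    by (simp_all add: v16_GHZ3_eq)
  then have "\<bar>v16_GHZ3 - 1229 / 2500\<bar> \<le> 1 / 200000"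
    by (intro abs_leI) linarith+
  then show "\<bar>v16_GHZ3 - 0.49160\<bar> \<le> 0.000005" by simp
  show "GHZ_threshold (equatorial_direction 16 ` {1..16}) = v16_GHZ3"
    unfolding GHZ_threshold_def direction_image[symmetric]
  proof (rule cSup_eq_maximum)
    show "v16_GHZ3 \<in> {v \<in> {0..1}. GHZ_local (direction ` I16) v}"
      using local_at_v16 v16_pos bounds(2) by simp
  qed (use GHZ_local_le in blast)
  show "vc_GHZ3 \<le> v16_GHZ3"
    unfolding vc_GHZ3_def GHZ_threshold_def
  proof (rule cSup_least)
    show "{v \<in> {0..1}. GHZ_local (sphere 0 1) v} \<noteq> {}" using GHZ_local_zero[of "sphere 0 1"] by force
    have "direction ` I16 \<subseteq> sphere 0 1" by (auto simp: norm_direction)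
    then show "v \<le> v16_GHZ3" if "v \<in> {v \<in> {0..1}. GHZ_local (sphere 0 1) v}" for v
      using that GHZ_local_le by blast
  qed
qed

end
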